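(* Let $A$ be a finitely generated abelian group with two elements $a, b \in A$ of the same order, and let $G$ be the HNN-extension $$G = \langle A, t \mid t a t^{-1} = b \rangle.$$ Then the following are equivalent: (i) $G$ has property (VRC); (ii) $G$ is balanced; (iii) either $\langle a \rangle \cap \langle b \rangle = \{1\}$ or $b^m = a^{\pm m}$ in $A$, for some $m \in \mathbb{N}$.
   Context: A subgroup $H$ of a group $G$ is a virtual retract of $G$ if there is a finite index subgroup $K$ of $G$ such that $H \subseteq K$ and there is a homomorphism $\rho: K \to H$ whose restriction to $H$ is the identity map. A group has property (VRC) if every cyclic subgroup is a virtual retract. A group $G$ is balanced if for every infinite order element $g \in G$ and all $k,l \in \mathbb{Z}\setminus\{0\}$, if $g^k$ is conjugate to $g^l$ in $G$ then $l = \pm k$. $\mathbb{N}$ denotes the positive integers; the condition $b^m = a^{\pm m}$ means $b^m = a^m$ or $b^m = a^{-m}$. Elements of the same order may both have infinite order. *)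

theory Defs
  imports "HOL-Algebra.Elementary_Groups" "HOL-Algebra.Multiplicative_Group"
begin

section \<open>Group presentations\<close>

text \<open>A word over generators \<open>X\<close> is a list of letters \<open>(x, e)\<close>: \<open>(x, True)\<close> stands for \<open>x\<close> and
  \<open>(x, False)\<close> for its inverse.\<close>

type_synonym 'x word = "('x \<times> bool) list"

definition words :: "'x set \<Rightarrow> 'x word set" where
  "words X = lists (X \<times> UNIV)"

inductive_set pres_rel :: "'x set \<Rightarrow> 'x word set \<Rightarrow> ('x word \<times> 'x word) set"
  for X :: "'x set" and R :: "'x word set" where
  refl: "w \<in> words X \<Longrightarrow> (w, w) \<in> pres_rel X R"
| sym: "(u, v) \<in> pres_rel X R \<Longrightarrow> (v, u) \<in> pres_rel X R"
| trans: "(u, v) \<in> pres_rel X R \<Longrightarrow> (v, w) \<in> pres_rel X R \<Longrightarrow> (u, w) \<in> pres_rel X R"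
| append: "(u, u') \<in> pres_rel X R \<Longrightarrow> (v, v') \<in> pres_rel X R \<Longrightarrow> (u @ v, u' @ v') \<in> pres_rel X R"
| cancel: "x \<in> X \<Longrightarrow> ([(x, e), (x, \<not> e)], []) \<in> pres_rel X R"
| relator: "r \<in> R \<Longrightarrow> r \<in> words X \<Longrightarrow> (r, []) \<in> pres_rel X R"

definition presented_group :: "'x set \<Rightarrow> 'x word set \<Rightarrow> 'x word set monoid" where
  "presented_group X R =
    \<lparr>carrier = words X // pres_rel X R,
     mult = (\<lambda>U V. \<Union>u\<in>U. \<Union>v\<in>V. pres_rel X R `` {u @ v}),
     one = pres_rel X R `` {[]}\<rparr>"

lemma pres_rel_words: "(u, v) \<in> pres_rel X R \<Longrightarrow> u \<in> words X \<and> v \<in> words X"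
  by (induction rule: pres_rel.induct) (auto simp: words_def)

lemma equiv_pres_rel: "equiv (words X) (pres_rel X R)"
proof (rule equivI)
  show "pres_rel X R \<subseteq> words X \<times> words X"
    using pres_rel_words by fastforce
  show "refl_on (words X) (pres_rel X R)"
    by (auto intro!: refl_onI pres_rel.refl)
  show "sym (pres_rel X R)"
    by (auto intro!: symI pres_rel.sym)
  show "trans (pres_rel X R)"
    by (auto intro!: transI intro: pres_rel.trans)
qed

lemma words_append: "u \<in> words X \<Longrightarrow> v \<in> words X \<Longrightarrow> u @ v \<in> words X"
  by (auto simp: words_def)

lemma presented_group_mult:
  assumes "u \<in> words X" "v \<in> words X"
  shows "pres_rel X R `` {u} \<otimes>\<^bsub>presented_group X R\<^esub> pres_rel X R `` {v} = pres_rel X R `` {u @ v}"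
proof -
  have "congruent2 (pres_rel X R) (pres_rel X R) (\<lambda>u v. pres_rel X R `` {u @ v})"
    by (intro congruent2I' equiv_class_eq[OF equiv_pres_rel] pres_rel.append)
  then show ?thesis
    using UN_equiv_class2[OF equiv_pres_rel equiv_pres_rel] assms
    by (simp add: presented_group_def)
qed

lemma pres_rel_inverse:
  "w \<in> words X \<Longrightarrow> (rev (map (\<lambda>(x, e). (x, \<not> e)) w) @ w, []) \<in> pres_rel X R"
proof (induction w)
  case Nil
  then show ?case by (simp add: pres_rel.refl)
next
  case (Cons p w)
  obtain x e where p: "p = (x, e)" by fastforce
  let ?v = "rev (map (\<lambda>(x, e). (x, \<not> e)) w)"
  have x: "x \<in> X" and w: "w \<in> words X" and v: "?v \<in> words X"
    using Cons.prems p by (auto simp: words_def)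
  have "([(x, \<not> e), (x, \<not> \<not> e)] @ w, [] @ w) \<in> pres_rel X R"
    by (intro pres_rel.append pres_rel.cancel pres_rel.refl x w)
  then have "(?v @ ([(x, \<not> e), (x, e)] @ w), ?v @ w) \<in> pres_rel X R"
    using pres_rel.append[OF pres_rel.refl[OF v]] by simp
  then show ?case
    using Cons.IH[OF w] p by (auto intro: pres_rel.trans)
qed

lemma group_presented_group: "group (presented_group X R)"
proof (rule groupI)
  let ?G = "presented_group X R"
  have car: "\<exists>u\<in>words X. U = pres_rel X R `` {u}" if "U \<in> carrier ?G" for U
    using that by (auto simp: presented_group_def elim: quotientE)
  have cls: "pres_rel X R `` {u} \<in> carrier ?G" if "u \<in> words X" for u
    using that by (auto simp: presented_group_def intro: quotientI)
  have nil: "[] \<in> words X" by (simp add: words_def)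
  have one: "\<one>\<^bsub>?G\<^esub> = pres_rel X R `` {[]}" by (simp add: presented_group_def)
  show "\<one>\<^bsub>?G\<^esub> \<in> carrier ?G" using one cls nil by simp
  show "U \<otimes>\<^bsub>?G\<^esub> V \<in> carrier ?G" if "U \<in> carrier ?G" "V \<in> carrier ?G" for U V
    using car[OF that(1)] car[OF that(2)] by (auto simp: presented_group_mult cls words_append)
  show "U \<otimes>\<^bsub>?G\<^esub> V \<otimes>\<^bsub>?G\<^esub> W = U \<otimes>\<^bsub>?G\<^esub> (V \<otimes>\<^bsub>?G\<^esub> W)"
    if "U \<in> carrier ?G" "V \<in> carrier ?G" "W \<in> carrier ?G" for U V W
    using car[OF that(1)] car[OF that(2)] car[OF that(3)]
    by (auto simp: presented_group_mult words_append)
  show "\<one>\<^bsub>?G\<^esub> \<otimes>\<^bsub>?G\<^esub> U = U" if "U \<in> carrier ?G" for U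
    using car[OF that] by (auto simp: one presented_group_mult nil)
  show "\<exists>V\<in>carrier ?G. V \<otimes>\<^bsub>?G\<^esub> U = \<one>\<^bsub>?G\<^esub>" if U: "U \<in> carrier ?G" for U
  proof -
    obtain u where u: "u \<in> words X" "U = pres_rel X R `` {u}" using car[OF U] by blast
    let ?v = "rev (map (\<lambda>(x, e). (x, \<not> e)) u)"
    have v: "?v \<in> words X" using u by (auto simp: words_def)
    have "pres_rel X R `` {?v} \<otimes>\<^bsub>?G\<^esub> U = \<one>\<^bsub>?G\<^esub>"
      using u v equiv_class_eq[OF equiv_pres_rel pres_rel_inverse[OF u(1)]]
      by (simp add: presented_group_mult one)
    then show ?thesis using cls[OF v] by blast
  qed
qed


section \<open>The HNN-extension\<close>

text \<open>The group \<open>\<langle>A, t | t a t\<^sup>-\<^sup>1 = b\<rangle>\<close>: generators are \<open>Some x\<close> for \<open>x\<close> in \<open>A\<close> and the stable letter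
  \<open>t = None\<close>; relators are the multiplication table of \<open>A\<close> together with \<open>t a t\<^sup>-\<^sup>1 b\<^sup>-\<^sup>1\<close>.\<close>

definition hnn_relators :: "('a, 'm) monoid_scheme \<Rightarrow> 'a \<Rightarrow> 'a \<Rightarrow> 'a option word set" where
  "hnn_relators A a b =
     {[(Some x, True), (Some y, True), (Some (x \<otimes>\<^bsub>A\<^esub> y), False)] | x y. x \<in> carrier A \<and> y \<in> carrier A}
     \<union> {[(None, True), (Some a, True), (None, False), (Some b, False)]}"

definition hnn_extension :: "('a, 'm) monoid_scheme \<Rightarrow> 'a \<Rightarrow> 'a \<Rightarrow> 'a option word set monoid" where
  "hnn_extension A a b = presented_group (insert None (Some ` carrier A)) (hnn_relators A a b)"


section \<open>Virtual retracts, property (VRC) and balanced groups\<close>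

definition finitely_generated_group :: "('a, 'm) monoid_scheme \<Rightarrow> bool" where
  "finitely_generated_group G \<longleftrightarrow> (\<exists>S. finite S \<and> S \<subseteq> carrier G \<and> generate G S = carrier G)"

definition virtual_retract :: "'a set \<Rightarrow> ('a, 'm) monoid_scheme \<Rightarrow> bool" where
  "virtual_retract H G \<longleftrightarrow>
     subgroup H G \<and>
     (\<exists>K. subgroup K G \<and> finite (rcosets\<^bsub>G\<^esub> K) \<and> H \<subseteq> K \<and>
       (\<exists>\<rho>\<in>hom (G\<lparr>carrier := K\<rparr>) (G\<lparr>carrier := H\<rparr>). \<forall>h\<in>H. \<rho> h = h))"

definition property_VRC :: "('a, 'm) monoid_scheme \<Rightarrow> bool" where
  "property_VRC G \<longleftrightarrow> (\<forall>g\<in>carrier G. virtual_retract (generate G {g}) G)"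

text \<open>In HOL-Algebra, \<open>group.ord G g = 0\<close> means that \<open>g\<close> has infinite order.\<close>

definition balanced :: "('a, 'm) monoid_scheme \<Rightarrow> bool" where
  "balanced G \<longleftrightarrow>
     (\<forall>g\<in>carrier G. group.ord G g = 0 \<longrightarrow>
       (\<forall>k l :: int. k \<noteq> 0 \<longrightarrow> l \<noteq> 0 \<longrightarrow>
         (\<exists>x\<in>carrier G. x \<otimes>\<^bsub>G\<^esub> (g [^]\<^bsub>G\<^esub> k) \<otimes>\<^bsub>G\<^esub> inv\<^bsub>G\<^esub> x = g [^]\<^bsub>G\<^esub> l) \<longrightarrow>
         l = k \<or> l = - k))"

end

theory Submission
  imports Defs
begin

text \<open>(VRC) implies balanced: if \<open>x g\<^sup>k x\<^sup>-\<^sup>1 = g\<^sup>l\<close>, a power \<open>x\<^sup>j\<close> lies in the finite index subgroup \<open>K\<close> that retracts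
  onto \<open>\<langle>g\<rangle>\<close>, and applying the retraction to \<open>x\<^sup>j g\<^bsup>k^j\<^esup> x\<^bsup>-j\<^esup> = g\<^bsup>l^j\<^esup>\<close> gives \<open>k^j = l^j\<close>.

  Balanced implies (iii): if \<open>a\<^sup>k = b\<^sup>l \<noteq> 1\<close> and \<open>a\<close> has infinite order in \<open>A\<close>, an affine action of \<open>G\<close> on the real
  line shows that \<open>a\<close> still has infinite order in \<open>G\<close>, where \<open>a\<^sup>l\<close> is conjugate to \<open>b\<^sup>l = a\<^sup>k\<close>.

  (iii) implies (VRC): actions of \<open>G\<close> are easy to construct, since \<open>t\<close> may be any permutation carrying the
  action of \<open>a\<close> to that of \<open>b\<close>; no normal form theorem is needed. Condition (iii) provides, for every
  \<open>g \<in> A\<close> of infinite order, a homomorphism \<open>\<phi> : A \<rightarrow> \<int>\<close> with \<open>\<phi> g \<noteq> 0\<close> and \<open>\<phi> b = \<plusminus>\<phi> a\<close>, hence finite quotients of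
  \<open>A\<close> separating any given elements in which \<open>a\<close> and \<open>b\<close> have the same order. Up to conjugation an
  element of \<open>G\<close> lies in \<open>A\<close> or is a cyclically reduced word. The former are handled by \<open>\<phi>\<close> or by a finite
  quotient; for the latter, \<open>t\<close> is chosen on copies of a finite quotient of \<open>A\<close> so that the word
  translates a fibre of a covering with group \<open>\<int>\<close>, as in the proof of Marshall Hall's theorem.\<close>

section \<open>Subgroups of finite index\<close>

lemma (in group) inv_cancel:
  assumes "x \<in> carrier G" "y \<in> carrier G"
  shows "inv x \<otimes> (x \<otimes> y) = y" "x \<otimes> (inv x \<otimes> y) = y"
  using assms by (simp_all flip: m_assoc)

lemma (in group) group_hom_conj:
  assumes "x \<in> carrier G"
  shows "group_hom G G (\<lambda>y. x \<otimes> y \<otimes> inv x)"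
  using assms by unfold_locales (auto simp: hom_def m_assoc inv_cancel)

lemma (in group) rcos_eq_iff:
  assumes "subgroup K G" "x \<in> carrier G" "y \<in> carrier G"
  shows "K #> x = K #> y \<longleftrightarrow> x \<otimes> inv y \<in> K"
proof
  assume "K #> x = K #> y"
  then have "x \<in> K #> y"
    using rcos_self assms by blast
  then obtain k where "k \<in> K" "x = k \<otimes> y"
    by (auto simp: r_coset_def)
  then show "x \<otimes> inv y \<in> K"
    using assms subgroup.mem_carrier[OF assms(1)] by (simp add: m_assoc)
next
  assume "x \<otimes> inv y \<in> K"
  then have "x \<in> K #> y"
    using assms subgroup.subset[OF assms(1)] rcosI[of "x \<otimes> inv y" K y] by (simp add: m_assoc)
  then show "K #> x = K #> y"
    using repr_independence[of x K y] assms by simp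
qed

text \<open>Equal values of \<open>f\<close> force equal right cosets, so the coset of
  \<open>x\<close> is a function of \<open>f x\<close> and there are at most as many cosets as
  values.\<close>

lemma (in group) finite_rcosets_if_finite_image:
  assumes K: "subgroup K G" and fin: "finite (f ` carrier G)"
    and f: "\<And>x y. x \<in> carrier G \<Longrightarrow> y \<in> carrier G \<Longrightarrow> f x = f y \<Longrightarrow> x \<otimes> inv y \<in> K"
  shows "finite (rcosets K)"
proof -
  have "rcosets K = (\<lambda>x. K #> x) ` carrier G"
    by (auto simp: RCOSETS_def)
  also have "\<dots> \<subseteq> (\<lambda>c. K #> (SOME x. x \<in> carrier G \<and> f x = c)) ` f ` carrier G"
  proof
    fix C assume "C \<in> (\<lambda>x. K #> x) ` carrier G"
    then obtain x where x: "x \<in> carrier G" "C = K #> x" by blast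
    let ?y = "SOME y. y \<in> carrier G \<and> f y = f x"
    have y: "?y \<in> carrier G \<and> f ?y = f x"
      by (rule someI[where x = x]) (use x in simp)
    then have "K #> x = K #> ?y"
      using f[of x ?y] rcos_eq_iff[OF K] x by auto
    then show "C \<in> (\<lambda>c. K #> (SOME x. x \<in> carrier G \<and> f x = c)) ` f ` carrier G"
      using x by auto
  qed
  finally show ?thesis
    using fin finite_subset by blast
qed

lemma (in group) finite_rcosets_rcos_image:
  assumes "subgroup K G" "finite (rcosets K)"
  shows "finite ((\<lambda>x. K #> x) ` carrier G)"
proof -
  have "(\<lambda>x. K #> x) ` carrier G = rcosets K"
    by (auto simp: RCOSETS_def)
  then show ?thesis using assms by simp
qed

text \<open>By the pigeonhole principle two of the cosets of the powers of \<open>x\<close>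
  coincide.\<close>

lemma (in group) ex_pow_in_finite_index:
  assumes K: "subgroup K G" "finite (rcosets K)" and x: "x \<in> carrier G"
  shows "\<exists>n::nat. n > 0 \<and> x [^] n \<in> K"
proof -
  have "finite ((\<lambda>n::nat. K #> x [^] n) ` UNIV)"
    by (rule finite_subset[OF _ finite_rcosets_rcos_image[OF K]]) (use x in auto)
  then have "\<not> inj (\<lambda>n::nat. K #> x [^] n)"
    using finite_imageD infinite_UNIV_nat by blast
  then obtain i j :: nat where ij: "i < j" "K #> x [^] j = K #> x [^] i"
    by (metis (mono_tags, lifting) injI linorder_neqE_nat)
  then have "x [^] j \<otimes> inv (x [^] i) \<in> K"
    using rcos_eq_iff[OF K(1)] x by simp
  moreover have "x [^] j \<otimes> inv (x [^] i) = x [^] (j - i)"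
    using ij(1) x by (metis inv_solve_right' le_add_diff_inverse2 less_imp_le nat_pow_closed nat_pow_mult)
  ultimately show ?thesis
    using ij(1) by (metis zero_less_diff)
qed

text \<open>Conjugation by \<open>x\<close> carries the retraction along: \<open>K\<close> is
  replaced by its image under \<open>c\<close>, and \<open>\<rho>\<close> by \<open>c\<close> after
  \<open>\<rho>\<close> after \<open>d\<close>, with \<open>d\<close> inverse to \<open>c\<close>.
  Later an element may thus be exchanged for a conjugate.\<close>

lemma (in group) virtual_retract_conj:
  assumes H: "virtual_retract (generate G {g}) G" and g: "g \<in> carrier G" and x: "x \<in> carrier G"
  shows "virtual_retract (generate G {x \<otimes> g \<otimes> inv x}) G"
proof -
  define c where "c = (\<lambda>y. x \<otimes> y \<otimes> inv x)"
  define d where "d = (\<lambda>y. inv x \<otimes> y \<otimes> x)"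
  obtain K \<rho> where K: "subgroup K G" "finite (rcosets K)" "generate G {g} \<subseteq> K"
    and \<rho>: "\<rho> \<in> hom (G\<lparr>carrier := K\<rparr>) (G\<lparr>carrier := generate G {g}\<rparr>)"
    and id: "\<And>h. h \<in> generate G {g} \<Longrightarrow> \<rho> h = h"
    using H unfolding virtual_retract_def by blast
  have Kc: "\<And>k. k \<in> K \<Longrightarrow> k \<in> carrier G"
    using subgroup.mem_carrier[OF K(1)] .
  have c_mult: "c (y \<otimes> z) = c y \<otimes> c z" and d_mult: "d (y \<otimes> z) = d y \<otimes> d z"
    if "y \<in> carrier G" "z \<in> carrier G" for y z
    using that x by (simp_all add: c_def d_def m_assoc inv_cancel)
  have dc: "d (c y) = y" and cd: "c (d y) = y" if "y \<in> carrier G" for y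
    using that x by (simp_all add: c_def d_def m_assoc inv_cancel)
  have c_iso: "group_hom G G c"
    using group_hom_conj[OF x] unfolding c_def .
  have d_closed: "d y \<in> carrier G" if "y \<in> carrier G" for y
    using that x by (simp add: d_def)
  have gen: "generate G {c g} = c ` generate G {g}"
    using group_hom.generate_img[OF c_iso, of "{g}"] g by simp
  let ?L = "c ` K"
  have L: "subgroup ?L G"
    using group_hom.subgroup_img_is_subgroup[OF c_iso K(1)] .
  have "finite (rcosets ?L)"
  proof (rule finite_rcosets_if_finite_image[OF L, where f = "\<lambda>y. K #> d y"])
    show "finite ((\<lambda>y. K #> d y) ` carrier G)"
      by (rule finite_subset[OF _ finite_rcosets_rcos_image[OF K(1,2)]])
        (intro image_subsetI imageI d_closed)
    fix y z assume yz: "y \<in> carrier G" "z \<in> carrier G" "K #> d y = K #> d z"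
    then have "d y \<otimes> inv (d z) \<in> K"
      using rcos_eq_iff[OF K(1), of "d y" "d z"] by (simp add: d_closed)
    moreover have "d y \<otimes> inv (d z) = d (y \<otimes> inv z)"
      using yz(1,2) x by (simp add: d_def m_assoc inv_mult_group inv_cancel)
    ultimately show "y \<otimes> inv z \<in> ?L"
      using cd[of "y \<otimes> inv z"] yz(1,2) by (metis image_eqI inv_closed m_closed)
  qed
  moreover have "(\<lambda>y. c (\<rho> (d y))) \<in> hom (G\<lparr>carrier := ?L\<rparr>) (G\<lparr>carrier := generate G {c g}\<rparr>)"
  proof (rule homI)
    have r: "\<rho> k \<in> generate G {g}" if "k \<in> K" for k
      using \<rho> that by (auto simp: hom_def)
    show "c (\<rho> (d y)) \<in> carrier (G\<lparr>carrier := generate G {c g}\<rparr>)"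
      if y: "y \<in> carrier (G\<lparr>carrier := ?L\<rparr>)" for y
    proof -
      obtain k where k: "k \<in> K" "y = c k"
        using y by auto
      then show ?thesis
        using r[OF k(1)] dc[OF Kc[OF k(1)]] by (simp add: gen)
    qed
    show "c (\<rho> (d (y \<otimes>\<^bsub>G\<lparr>carrier := ?L\<rparr>\<^esub> z))) = c (\<rho> (d y)) \<otimes>\<^bsub>G\<lparr>carrier := generate G {c g}\<rparr>\<^esub> c (\<rho> (d z))"
      if yz: "y \<in> carrier (G\<lparr>carrier := ?L\<rparr>)" "z \<in> carrier (G\<lparr>carrier := ?L\<rparr>)" for y z
    proof -
      obtain k l where kl: "k \<in> K" "l \<in> K" "y = c k" "z = c l"
        using yz by auto
      have "\<rho> (k \<otimes> l) = \<rho> k \<otimes> \<rho> l"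
        using \<rho> kl by (auto simp: hom_def)
      moreover have "\<rho> k \<in> carrier G" "\<rho> l \<in> carrier G"
        using r kl K(3) Kc by (meson subsetD)+
      ultimately show ?thesis
        using c_mult[of k l] c_mult[of "\<rho> k" "\<rho> l"] dc[of k] dc[of l] dc[of "k \<otimes> l"] kl Kc
        by simp
    qed
  qed
  moreover have "generate G {c g} \<subseteq> ?L"
    using gen K(3) by blast
  moreover have "\<forall>h\<in>generate G {c g}. c (\<rho> (d h)) = h"
  proof
    fix h assume "h \<in> generate G {c g}"
    then obtain u where u: "u \<in> generate G {g}" "h = c u"
      unfolding gen by blast
    then have "u \<in> carrier G"
      using K(3) Kc by (meson subsetD)
    then show "c (\<rho> (d h)) = h"
      using u id dc by simp
  qed
  moreover have "subgroup (generate G {c g}) G"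
    using generate_is_subgroup g x by (simp add: c_def)
  ultimately have "virtual_retract (generate G {c g}) G"
    unfolding virtual_retract_def using L by (intro conjI exI[of _ ?L] bexI[of _ "\<lambda>y. c (\<rho> (d y))"])
  then show ?thesis
    by (simp add: c_def)
qed

section \<open>Powers under conjugation, and (VRC) implies balanced\<close>

lemma (in group) conj_int_pow:
  assumes "x \<in> carrier G" "g \<in> carrier G"
  shows "x \<otimes> g [^] (k::int) \<otimes> inv x = (x \<otimes> g \<otimes> inv x) [^] k"
  using group_hom.hom_int_pow[OF group_hom_conj[OF assms(1)] assms(2)] by simp

lemma (in group) VRC_imp_balanced:
  assumes "property_VRC G"
  shows "balanced G"
  unfolding balanced_def
proof (intro ballI allI impI)
  fix g and k l :: int
  assume g: "g \<in> carrier G" and ord: "ord g = 0" and kl: "k \<noteq> 0" "l \<noteq> 0"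
    and "\<exists>x\<in>carrier G. x \<otimes> g [^] k \<otimes> inv x = g [^] l"
  then obtain x where x: "x \<in> carrier G" and eq: "x \<otimes> g [^] k \<otimes> inv x = g [^] l" by blast
  obtain K \<rho> where K: "subgroup K G" "finite (rcosets K)" "generate G {g} \<subseteq> K"
    and \<rho>: "\<rho> \<in> hom (G\<lparr>carrier := K\<rparr>) (G\<lparr>carrier := generate G {g}\<rparr>)"
    and id: "\<And>h. h \<in> generate G {g} \<Longrightarrow> \<rho> h = h"
    using assms g unfolding property_VRC_def virtual_retract_def by blast
  obtain n :: nat where n: "n > 0" "x [^] n \<in> K"
    using ex_pow_in_finite_index[OF K(1,2) x] by blast
  \<comment> \<open>The exponent \<open>k ^ j\<close> leaves room for \<open>j\<close> successive
    conjugations, each of which trades one factor \<open>k\<close> for a factor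
    \<open>l\<close>.\<close>
  have step: "x [^] j \<otimes> g [^] (k ^ j) \<otimes> inv (x [^] j) = g [^] (l ^ j)" for j :: nat
  proof (induction j)
    case 0 then show ?case using g by simp
  next
    case (Suc j)
    have "x [^] Suc j \<otimes> g [^] (k ^ Suc j) \<otimes> inv (x [^] Suc j)
        = x [^] j \<otimes> (x \<otimes> g [^] (k * k ^ j) \<otimes> inv x) \<otimes> inv (x [^] j)"
      using x g by (simp add: inv_mult_group m_assoc)
    also have "x \<otimes> g [^] (k * k ^ j) \<otimes> inv x = (g [^] l) [^] (k ^ j)"
      using conj_int_pow[of x "g [^] k" "k ^ j"] eq x g by (simp add: int_pow_pow)
    also have "\<dots> = (g [^] (k ^ j)) [^] l"
      using g by (simp add: int_pow_pow mult.commute)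
    also have "x [^] j \<otimes> (g [^] (k ^ j)) [^] l \<otimes> inv (x [^] j) = (g [^] (l ^ j)) [^] l"
      using conj_int_pow[of "x [^] j" "g [^] (k ^ j)" l] Suc x g by simp
    also have "\<dots> = g [^] (l ^ Suc j)"
      using g by (simp add: int_pow_pow mult.commute)
    finally show ?case .
  qed
  interpret H: group "G\<lparr>carrier := generate G {g}\<rparr>"
    using subgroup_imp_group[OF generate_is_subgroup] g by simp
  have gen: "generate G {g} = {g [^] k | k::int. True}"
    using generate_pow[OF g] by auto
  then have pw: "g [^] i \<in> generate G {g}" for i :: int by blast
  have r: "\<rho> y \<in> generate G {g}" if "y \<in> K" for y
    using \<rho> that by (auto simp: hom_def)
  have rm: "\<rho> (y \<otimes> z) = \<rho> y \<otimes> \<rho> z" if "y \<in> K" "z \<in> K" for y z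
    using \<rho> that by (auto simp: hom_def)
  obtain i :: int where i: "\<rho> (x [^] n) = g [^] i"
    using r[OF n(2)] gen by blast
  \<comment> \<open>In this form all factors lie in \<open>K\<close>. The retraction fixes the
    powers of \<open>g\<close> and sends \<open>x [^] n\<close> to some \<open>g [^] i\<close>,
    which then cancels.\<close>
  have "x [^] n \<otimes> g [^] (k ^ n) = g [^] (l ^ n) \<otimes> x [^] n"
    using step[of n] x g by (metis int_pow_closed inv_solve_right m_closed nat_pow_closed)
  then have "g [^] i \<otimes> g [^] (k ^ n) = g [^] (l ^ n) \<otimes> g [^] i"
    using rm[of "x [^] n" "g [^] (k ^ n)"] rm[of "g [^] (l ^ n)" "x [^] n"] n K(3) pw id i
    by (metis subsetD)
  then have "g [^] (i + k ^ n) = g [^] (l ^ n + i)"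
    using g by (simp add: int_pow_mult)
  then have "k ^ n = l ^ n"
    using int_pow_eq[OF g] ord by simp
  \<comment> \<open>Since \<open>n\<close> may be even, only the absolute values can be
    compared.\<close>
  then have "\<bar>k\<bar> = \<bar>l\<bar>"
    using n(1) by (metis abs_ge_zero power_abs power_eq_iff_eq_base)
  then show "l = k \<or> l = - k" by linarith
qed

section \<open>Finitely generated abelian groups\<close>

text \<open>Zorn's lemma: the union of a chain of subgroups avoiding \<open>X\<close> is again such
  a subgroup. \<open>X\<close> will be \<open>{g}\<close> for separation by finite index, and the
  set of powers of \<open>g\<close> with nonzero exponent for homomorphisms to the integers.\<close>

lemma (in group) ex_maximal_subgroup_avoiding:
  assumes "subgroup C G" "C \<inter> X = {}"
  shows "\<exists>B. subgroup B G \<and> C \<subseteq> B \<and> B \<inter> X = {} \<and>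
    (\<forall>B'. subgroup B' G \<longrightarrow> B \<subseteq> B' \<longrightarrow> B' \<inter> X = {} \<longrightarrow> B' = B)"
proof -
  let ?F = "{B. subgroup B G \<and> C \<subseteq> B \<and> B \<inter> X = {}}"
  have "\<exists>M\<in>?F. \<forall>B'\<in>?F. M \<subseteq> B' \<longrightarrow> B' = M"
  proof (rule subset_Zorn_nonempty)
    show "?F \<noteq> {}" using assms by blast
    fix \<C> assume ne: "\<C> \<noteq> {}" and ch: "subset.chain ?F \<C>"
    have sub: "\<And>B. B \<in> \<C> \<Longrightarrow> subgroup B G" and CB: "\<And>B. B \<in> \<C> \<Longrightarrow> C \<subseteq> B \<and> B \<inter> X = {}"
      using ch by (auto simp: subset.chain_def)
    have tot: "B \<subseteq> B' \<or> B' \<subseteq> B" if "B \<in> \<C>" "B' \<in> \<C>" for B B'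
      using ch that by (auto simp: subset_chain_def)
    have "subgroup (\<Union>\<C>) G"
    proof (rule subgroupI)
      show "\<Union>\<C> \<subseteq> carrier G"
        using sub by (meson Sup_least subgroup.subset)
      show "\<Union>\<C> \<noteq> {}"
        using ne sub subgroup.one_closed by (metis Sup_upper ex_in_conv subset_empty)
      show "inv x \<in> \<Union>\<C>" if "x \<in> \<Union>\<C>" for x
        using that sub by (meson UnionE UnionI subgroup.m_inv_closed)
      show "x \<otimes> y \<in> \<Union>\<C>" if xy: "x \<in> \<Union>\<C>" "y \<in> \<Union>\<C>" for x y
      proof -
        obtain B B' where "B \<in> \<C>" "B' \<in> \<C>" "x \<in> B" "y \<in> B'"
          using xy by blast
        then obtain D where "D \<in> \<C>" "x \<in> D" "y \<in> D"
          using tot[of B B'] by blast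
        then show ?thesis
          using subgroup.m_closed[OF sub[of D], of x y] by auto
      qed
    qed
    then show "\<Union>\<C> \<in> ?F"
      using ne CB by (auto simp: Int_Union2)
  qed
  then obtain M where M: "M \<in> ?F" "\<forall>B'\<in>?F. M \<subseteq> B' \<longrightarrow> B' = M"
    by (elim bexE)
  show ?thesis
  proof (intro exI[of _ M] conjI allI impI)
    show "B' = M" if "subgroup B' G" "M \<subseteq> B'" "B' \<inter> X = {}" for B'
      using M that by (simp add: subset_trans[of C M B'])
  qed (use M(1) in simp_all)
qed

lemma (in comm_group) subgroup_mult_cyclic:
  assumes B: "subgroup B G" and s: "s \<in> carrier G"
  shows "subgroup {b \<otimes> s [^] j | b (j::int). b \<in> B} G"
proof (rule subgroupI)
  have Bc: "\<And>b. b \<in> B \<Longrightarrow> b \<in> carrier G"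
    using subgroup.mem_carrier[OF B] .
  let ?M = "{b \<otimes> s [^] j | b (j::int). b \<in> B}"
  show "?M \<subseteq> carrier G"
    using Bc s by auto
  show "?M \<noteq> {}"
    using subgroup.one_closed[OF B] by blast
  show "inv x \<in> ?M" if x: "x \<in> ?M" for x
  proof -
    obtain b and j :: int where b: "b \<in> B" "x = b \<otimes> s [^] j" using x by blast
    then have "inv x = inv b \<otimes> s [^] (- j)"
      using Bc s by (simp add: inv_mult int_pow_neg)
    then show ?thesis
      using subgroup.m_inv_closed[OF B b(1)] by blast
  qed
  show "x \<otimes> y \<in> ?M" if xy: "x \<in> ?M" "y \<in> ?M" for x y
  proof -
    obtain b c and i j :: int where b: "b \<in> B" "x = b \<otimes> s [^] i" "c \<in> B" "y = c \<otimes> s [^] j"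
      using xy by blast
    then have "x \<otimes> y = (b \<otimes> c) \<otimes> s [^] (i + j)"
      using Bc s by (simp add: int_pow_mult m_ac)
    then show ?thesis
      using subgroup.m_closed[OF B b(1,3)] by blast
  qed
qed

text \<open>The subgroup generated by \<open>B\<close> and \<open>s\<close> is strictly larger than
  \<open>B\<close>, so maximality forces it to meet \<open>X\<close>.\<close>

lemma (in comm_group) maximal_avoiding_meets:
  assumes B: "subgroup B G"
    and max: "\<And>B'. subgroup B' G \<Longrightarrow> B \<subseteq> B' \<Longrightarrow> B' \<inter> X = {} \<Longrightarrow> B' = B"
    and s: "s \<in> carrier G" "s \<notin> B"
  shows "\<exists>b\<in>B. \<exists>j::int. b \<otimes> s [^] j \<in> X"
proof (rule ccontr)
  assume neg: "\<not> ?thesis"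
  let ?M = "{b \<otimes> s [^] j | b (j::int). b \<in> B}"
  have Bc: "\<And>b. b \<in> B \<Longrightarrow> b \<in> carrier G"
    using subgroup.mem_carrier[OF B] .
  have "b \<in> ?M" if "b \<in> B" for b
    using that Bc[OF that] by (intro CollectI exI[of _ b] exI[of _ 0]) simp
  moreover have "?M \<inter> X = {}"
    using neg by blast
  ultimately have "?M = B"
    using max[OF subgroup_mult_cyclic[OF B s(1)]] by blast
  moreover have "s \<in> ?M"
    using subgroup.one_closed[OF B] s by (intro CollectI exI[of _ "\<one>"] exI[of _ 1]) simp
  ultimately show False
    using s(2) by blast
qed

section \<open>Uniform exponents and separation by subgroups of finite index\<close>

lemma (in group) pow_in_subgroup_int_iff:
  assumes "subgroup M G" "s \<in> carrier G" "s [^] (j::int) \<in> M"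
  shows "s [^] (nat \<bar>j\<bar>) \<in> M"
proof (cases "j \<ge> 0")
  case True
  then show ?thesis using assms(3) int_pow_int[of G s "nat \<bar>j\<bar>"] by simp
next
  case False
  then have "s [^] (nat \<bar>j\<bar>) = inv (s [^] j)"
    using int_pow_int[of G s "nat \<bar>j\<bar>"] int_pow_neg[OF assms(2), of j] by simp
  then show ?thesis
    using subgroup.m_inv_closed[OF assms(1,3)] by simp
qed

text \<open>The product of the exponents of finitely many generators serves all elements, because in
  an abelian group the \<open>s\<close> with \<open>s [^] N\<close> in \<open>M\<close> form a
  subgroup.\<close>

lemma (in comm_group) uniform_exponent:
  assumes fg: "finitely_generated_group G" and M: "subgroup M G"
    and tors: "\<And>s. s \<in> carrier G \<Longrightarrow> \<exists>j::nat. j > 0 \<and> s [^] j \<in> M"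
  shows "\<exists>N::nat. N > 0 \<and> (\<forall>s\<in>carrier G. s [^] N \<in> M)"
proof -
  obtain S where S: "finite S" "S \<subseteq> carrier G" "generate G S = carrier G"
    using fg unfolding finitely_generated_group_def by blast
  obtain e :: "'a \<Rightarrow> nat" where e: "\<And>s. s \<in> carrier G \<Longrightarrow> e s > 0 \<and> s [^] e s \<in> M"
    using tors by metis
  define N where "N = (\<Prod>s\<in>S. e s)"
  have N: "N > 0"
    unfolding N_def using S e by (intro prod_pos) auto
  let ?P = "{s \<in> carrier G. s [^] N \<in> M}"
  have "S \<subseteq> ?P"
  proof
    fix s assume s: "s \<in> S"
    then have sc: "s \<in> carrier G" using S by blast
    obtain q where q: "N = e s * q"
      using dvd_prodI[OF S(1) s, of e] unfolding N_def by (auto simp: dvd_def)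
    have "(s [^] e s) [^] int q \<in> M"
      using subgroup_int_pow_closed[OF M] e[OF sc] by blast
    then show "s \<in> ?P"
      using sc q by (simp add: int_pow_int nat_pow_pow)
  qed
  moreover have "subgroup ?P G"
  proof (rule subgroupI)
    show "?P \<subseteq> carrier G" by blast
    show "?P \<noteq> {}" using subgroup.one_closed[OF M] by (auto intro!: exI[of _ \<one>])
    show "inv x \<in> ?P" if "x \<in> ?P" for x
      using that subgroup.m_inv_closed[OF M] by (auto simp: nat_pow_inv)
    show "x \<otimes> y \<in> ?P" if "x \<in> ?P" "y \<in> ?P" for x y
      using that subgroup.m_closed[OF M] by (auto simp: pow_mult_distrib m_comm)
  qed
  ultimately have "generate G S \<subseteq> ?P"
    using generate_subgroup_incl by blast
  then show ?thesis
    using N S by blast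
qed

text \<open>A finite set of coset representatives is built one generator at a time: when
  \<open>s\<close> is added, its exponent is reduced modulo \<open>N\<close>, since
  \<open>s [^] N\<close> lies in \<open>M\<close>.\<close>

lemma (in comm_group) finite_index_if_uniform_exponent:
  assumes fg: "finitely_generated_group G" and M: "subgroup M G"
    and N: "N > 0" "\<And>s. s \<in> carrier G \<Longrightarrow> s [^] (N::nat) \<in> M"
  shows "finite (rcosets M)"
proof -
  obtain S where S: "finite S" "S \<subseteq> carrier G" "generate G S = carrier G"
    using fg unfolding finitely_generated_group_def by blast
  have "\<exists>T. finite T \<and> T \<subseteq> carrier G \<and> (\<forall>x\<in>generate G S. \<exists>m\<in>M. \<exists>t\<in>T. x = m \<otimes> t)"
    using S(1,2)
  proof (induction S rule: finite_induct)
    case empty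
    have "\<forall>x\<in>generate G {}. \<exists>m\<in>M. \<exists>t\<in>{\<one>}. x = m \<otimes> t"
      using subgroup.one_closed[OF M] by (simp add: generate_empty bexI[of _ \<one>])
    then show ?case by blast
  next
    case (insert s S)
    obtain T where T: "finite T" "T \<subseteq> carrier G" "\<And>x. x \<in> generate G S \<Longrightarrow> \<exists>m\<in>M. \<exists>t\<in>T. x = m \<otimes> t"
      using insert.IH insert.prems by (meson insert_subset)
    have s: "s \<in> carrier G" and Sc: "S \<subseteq> carrier G" using insert.prems by simp_all
    let ?T = "(\<lambda>(t, i). t \<otimes> s [^] i) ` (T \<times> {..<N})"
    let ?D = "{b \<otimes> s [^] j | b (j::int). b \<in> generate G S}"
    have D: "subgroup ?D G"
      using subgroup_mult_cyclic[OF generate_is_subgroup[OF Sc] s] .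
    have "insert s S \<subseteq> ?D"
    proof
      fix x assume "x \<in> insert s S"
      then consider "x = s" | "x \<in> S" by blast
      then show "x \<in> ?D"
      proof cases
        case 1
        then show ?thesis
          using s by (intro CollectI exI[of _ "\<one>"] exI[of _ 1]) (auto intro: generate.one)
      next
        case 2
        then show ?thesis
          using Sc by (intro CollectI exI[of _ x] exI[of _ 0]) (auto intro: generate.incl)
      qed
    qed
    then have gD: "generate G (insert s S) \<subseteq> ?D"
      using generate_subgroup_incl[OF _ D] by blast
    have "\<exists>m\<in>M. \<exists>t\<in>?T. x = m \<otimes> t" if x: "x \<in> generate G (insert s S)" for x
    proof -
      obtain b and j :: int where b: "b \<in> generate G S" "x = b \<otimes> s [^] j"
        using gD x by blast
      obtain m t where mt: "m \<in> M" "t \<in> T" "b = m \<otimes> t"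
        using T(3)[OF b(1)] by blast
      have "j = int N * (j div int N) + int (nat (j mod int N))"
        using N(1) by simp
      then have "s [^] j = (s [^] N) [^] (j div int N) \<otimes> s [^] nat (j mod int N)"
        using s by (metis int_pow_int int_pow_mult int_pow_pow)
      then have "x = (m \<otimes> (s [^] N) [^] (j div int N)) \<otimes> (t \<otimes> s [^] nat (j mod int N))"
        using b mt s T(2) subgroup.mem_carrier[OF M mt(1)] by (auto simp: m_ac)
      moreover have "m \<otimes> (s [^] N) [^] (j div int N) \<in> M"
        using subgroup.m_closed[OF M mt(1) subgroup_int_pow_closed[OF M N(2)[OF s]]] .
      moreover have "t \<otimes> s [^] nat (j mod int N) \<in> ?T"
        using mt N(1) by (intro image_eqI[of _ _ "(t, nat (j mod int N))"]) (auto simp: nat_less_iff)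
      ultimately show ?thesis by blast
    qed
    moreover have "finite ?T" using T by simp
    moreover have "?T \<subseteq> carrier G" using T s by auto
    ultimately show ?case by blast
  qed
  then obtain T where T: "finite T" "T \<subseteq> carrier G" "\<And>x. x \<in> carrier G \<Longrightarrow> \<exists>m\<in>M. \<exists>t\<in>T. x = m \<otimes> t"
    using S(3) by auto
  have "rcosets M \<subseteq> (\<lambda>t. M #> t) ` T"
  proof
    fix C assume "C \<in> rcosets M"
    then obtain x where x: "x \<in> carrier G" "C = M #> x" by (auto simp: RCOSETS_def)
    then obtain m t where mt: "m \<in> M" "t \<in> T" "x = m \<otimes> t" using T(3) by blast
    then have "x \<otimes> inv t \<in> M"
      using T(2) subgroup.mem_carrier[OF M mt(1)] by (auto simp: m_assoc)
    then show "C \<in> (\<lambda>t. M #> t) ` T"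
      using x mt(2) T(2) rcos_eq_iff[OF M, of x t] by auto
  qed
  then show ?thesis
    using T(1) finite_surj by blast
qed

text \<open>Take \<open>B\<close> above \<open>C\<close> maximal among the subgroups missing
  \<open>g\<close>. An \<open>s\<close> without positive powers in \<open>B\<close> would give
  \<open>g\<close> in \<open>B s^i\<close> with \<open>i\<close> nonzero and, by maximality applied
  to \<open>s^(2i)\<close>, also in \<open>B s^(2ij)\<close>; then \<open>i = 2ij\<close>, which
  parity excludes. So every element has a positive power in \<open>B\<close>, and finite generation
  yields finite index.\<close>

lemma (in comm_group) separate_by_finite_index:
  assumes fg: "finitely_generated_group G" and C: "subgroup C G" and g: "g \<in> carrier G" "g \<notin> C"
  shows "\<exists>B. subgroup B G \<and> finite (rcosets B) \<and> C \<subseteq> B \<and> g \<notin> B"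
proof -
  obtain B where B: "subgroup B G" "C \<subseteq> B" "g \<notin> B"
    and max: "\<And>B'. subgroup B' G \<Longrightarrow> B \<subseteq> B' \<Longrightarrow> B' \<inter> {g} = {} \<Longrightarrow> B' = B"
    using ex_maximal_subgroup_avoiding[of C "{g}"] C g(2) by auto
  have Bc: "\<And>b. b \<in> B \<Longrightarrow> b \<in> carrier G"
    using subgroup.mem_carrier[OF B(1)] .
  have key: "\<exists>b\<in>B. \<exists>j::int. g = b \<otimes> s [^] j" if s: "s \<in> carrier G" "s \<notin> B" for s
  proof -
    obtain b and j :: int where "b \<in> B" "b \<otimes> s [^] j \<in> {g}"
      using maximal_avoiding_meets[OF B(1) max s] by blast
    then show ?thesis by (metis singletonD)
  qed
  have "\<exists>j::nat. j > 0 \<and> s [^] j \<in> B" if s: "s \<in> carrier G" for s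
  proof (rule ccontr)
    assume "\<not> ?thesis"
    then have neg: "s [^] i \<notin> B" if "i > 0" for i :: nat
      using that by metis
    have no: "j = 0" if "s [^] (j::int) \<in> B" for j
      using pow_in_subgroup_int_iff[OF B(1) s that] neg[of "nat \<bar>j\<bar>"] by linarith
    have "s \<notin> B" using no[of 1] int_pow_1[OF s] by (metis zero_neq_one)
    then obtain b1 and i :: int where i: "b1 \<in> B" "g = b1 \<otimes> s [^] i"
      using key[OF s] by blast
    have "i \<noteq> 0"
    proof
      assume "i = 0"
      then have "g = b1" using i(2) Bc[OF i(1)] by simp
      then show False using i(1) B(3) by simp
    qed
    then have "s [^] (2 * i) \<notin> B" using no[of "2 * i"] by linarith
    then obtain b2 and j :: int where j: "b2 \<in> B" "g = b2 \<otimes> (s [^] (2 * i)) [^] j"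
      using key[OF int_pow_closed[OF s]] by blast
    have e: "b1 \<otimes> s [^] i = b2 \<otimes> s [^] (2 * i * j)"
      using i j s by (simp add: int_pow_pow)
    have "s [^] (i - 2 * i * j) = s [^] i \<otimes> inv (s [^] (2 * i * j))"
      using s by (simp add: int_pow_diff)
    also have "\<dots> = inv b1 \<otimes> (b1 \<otimes> s [^] i) \<otimes> inv (s [^] (2 * i * j))"
      using s Bc[OF i(1)] by (simp add: inv_cancel)
    also have "\<dots> = inv b1 \<otimes> b2"
      unfolding e using s Bc[OF i(1)] Bc[OF j(1)] by (simp add: m_assoc)
    also have "\<dots> \<in> B"
      using subgroup.m_closed[OF B(1) subgroup.m_inv_closed[OF B(1) i(1)] j(1)] .
    finally have "i * (1 - 2 * j) = 0"
      using no[of "i - 2 * i * j"] by (simp add: algebra_simps)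
    then have "1 - 2 * j = 0"
      using \<open>i \<noteq> 0\<close> by simp
    then show False by presburger
  qed
  then obtain N :: nat where "N > 0" "\<And>s. s \<in> carrier G \<Longrightarrow> s [^] N \<in> B"
    using uniform_exponent[OF fg B(1)] by blast
  then have "finite (rcosets B)"
    using finite_index_if_uniform_exponent[OF fg B(1)] by blast
  then show ?thesis
    using B by blast
qed

text \<open>Choose \<open>B \<supseteq> C\<close> maximal among the subgroups meeting \<open>\<langle>g\<rangle>\<close> trivially. By maximality some power
  \<open>s\<^sup>N\<close> of every \<open>s\<close> lies in \<open>B\<langle>g\<rangle>\<close>, uniformly in \<open>s\<close>, and \<open>\<phi> s\<close> is the exponent in \<open>s\<^sup>N \<in> B g\<^bsup>\<phi> s\<^esup>\<close>.
  This avoids the structure theorem for finitely generated abelian groups.\<close>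

lemma (in comm_group) separating_hom_int:
  assumes fg: "finitely_generated_group G" and C: "subgroup C G" and g: "g \<in> carrier G"
    and gC: "\<And>k::int. g [^] k \<in> C \<Longrightarrow> k = 0"
  shows "\<exists>\<phi>\<in>hom G integer_group. \<phi> g \<noteq> 0 \<and> (\<forall>c\<in>C. \<phi> c = 0)"
proof -
  let ?X = "{g [^] k | k::int. k \<noteq> 0}"
  have "C \<inter> ?X = {}" using gC by blast
  from ex_maximal_subgroup_avoiding[OF C this]
  obtain B where B: "subgroup B G" "C \<subseteq> B" "B \<inter> ?X = {}"
    and max: "\<And>B'. subgroup B' G \<Longrightarrow> B \<subseteq> B' \<Longrightarrow> B' \<inter> ?X = {} \<Longrightarrow> B' = B"
    by (elim exE conjE) simp
  have Bc: "\<And>b. b \<in> B \<Longrightarrow> b \<in> carrier G"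
    using subgroup.mem_carrier[OF B(1)] .
  have gB: "k = 0" if "g [^] (k::int) \<in> B" for k
    using B(3) that by blast
  let ?M = "{b \<otimes> g [^] j | b (j::int). b \<in> B}"
  have M: "subgroup ?M G"
    using subgroup_mult_cyclic[OF B(1) g] .
  have "\<exists>j::nat. j > 0 \<and> s [^] j \<in> ?M" if s: "s \<in> carrier G" for s
  proof (cases "s \<in> B")
    case True
    then have "s [^] (1::nat) = s \<otimes> g [^] (0::int)" using s by simp
    then have "s [^] (1::nat) \<in> ?M" using True by blast
    then show ?thesis by (intro exI[of _ 1]) simp
  next
    case False
    obtain b and j :: int where bj: "b \<in> B" "b \<otimes> s [^] j \<in> ?X"
      using maximal_avoiding_meets[OF B(1) max s False] by blast
    then obtain k :: int where k: "b \<otimes> s [^] j = g [^] k" "k \<noteq> 0" by blast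
    have "j \<noteq> 0"
      using k gB[of k] bj(1) Bc by auto
    have "s [^] j = inv b \<otimes> g [^] k"
      using k(1) s Bc[OF bj(1)] by (metis inv_cancel(1) int_pow_closed)
    then have "s [^] j \<in> ?M"
      using subgroup.m_inv_closed[OF B(1) bj(1)] by blast
    then show ?thesis
      using pow_in_subgroup_int_iff[OF M s] \<open>j \<noteq> 0\<close> by (intro exI[of _ "nat \<bar>j\<bar>"]) auto
  qed
  then obtain N :: nat where N: "N > 0" "\<And>s. s \<in> carrier G \<Longrightarrow> s [^] N \<in> ?M"
    using uniform_exponent[OF fg M] by blast
  \<comment> \<open>Two exponents for the same \<open>s\<close> differ by the exponent of a power of
    \<open>g\<close> lying in \<open>B\<close>, hence agree; this makes \<phi> well defined.\<close>
  have uniq: "j = k" if "s [^] N = b \<otimes> g [^] j" "s [^] N = c \<otimes> g [^] k" "b \<in> B" "c \<in> B"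
    for s b c and j k :: int
  proof -
    have "g [^] (j - k) = inv b \<otimes> (b \<otimes> g [^] j) \<otimes> inv (g [^] k)"
      using g Bc[OF that(3)] by (simp add: inv_cancel int_pow_diff)
    also have "\<dots> = inv b \<otimes> c"
      unfolding that(1)[symmetric] that(2) using g Bc[OF that(3)] Bc[OF that(4)] by (simp add: m_assoc)
    also have "\<dots> \<in> B"
      using subgroup.m_closed[OF B(1) subgroup.m_inv_closed[OF B(1) that(3)] that(4)] .
    finally show ?thesis using gB[of "j - k"] by simp
  qed
  define \<phi> where "\<phi> s = (THE j. \<exists>b\<in>B. s [^] N = b \<otimes> g [^] (j::int))" for s
  have \<phi>_eq: "\<phi> s = j" if "b \<in> B" "s [^] N = b \<otimes> g [^] j" for s b j
    unfolding \<phi>_def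
  proof (rule the_equality)
    show "\<exists>b\<in>B. s [^] N = b \<otimes> g [^] j" using that by blast
    show "k = j" if "\<exists>b\<in>B. s [^] N = b \<otimes> g [^] k" for k
      using that uniq \<open>b \<in> B\<close> \<open>s [^] N = b \<otimes> g [^] j\<close> by metis
  qed
  have \<phi>_ex: "\<exists>b\<in>B. s [^] N = b \<otimes> g [^] \<phi> s" if "s \<in> carrier G" for s
    using N(2)[OF that] \<phi>_eq by fastforce
  have "\<phi> \<in> hom G integer_group"
  proof (rule homI)
    fix x y assume xy: "x \<in> carrier G" "y \<in> carrier G"
    obtain b c where bc: "b \<in> B" "c \<in> B" "x [^] N = b \<otimes> g [^] \<phi> x" "y [^] N = c \<otimes> g [^] \<phi> y"
      using \<phi>_ex xy by blast
    have "(x \<otimes> y) [^] N = (b \<otimes> c) \<otimes> g [^] (\<phi> x + \<phi> y)"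
      using xy bc g Bc by (simp add: nat_pow_distrib int_pow_mult m_ac)
    then show "\<phi> (x \<otimes> y) = \<phi> x \<otimes>\<^bsub>integer_group\<^esub> \<phi> y"
      using \<phi>_eq subgroup.m_closed[OF B(1) bc(1,2)] by simp
  qed simp
  moreover have "\<phi> g = int N"
    using g subgroup.one_closed[OF B(1)] by (intro \<phi>_eq[of \<one>]) (simp_all add: int_pow_int)
  moreover have "\<phi> c = 0" if "c \<in> C" for c
  proof -
    have c: "c \<in> B" using that B(2) by blast
    then have "c [^] N \<in> B"
      using subgroup_int_pow_closed[OF B(1) c, of "int N"] by (simp add: int_pow_int)
    then show ?thesis
      using Bc by (intro \<phi>_eq[of "c [^] N"]) simp_all
  qed
  ultimately show ?thesis
    using N(1) by (intro bexI[of _ \<phi>]) auto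
qed

section \<open>Virtual retracts from actions\<close>

lemma (in group) action_inv:
  assumes one: "act \<one> = id"
    and mult: "\<And>x y. x \<in> carrier G \<Longrightarrow> y \<in> carrier G \<Longrightarrow> act (x \<otimes> y) = act x \<circ> act y"
    and x: "x \<in> carrier G"
  shows "act (inv x) (act x p) = p" "act x (act (inv x) p) = p"
  using mult[of "inv x" x] mult[of x "inv x"] x one by (simp_all add: fun_eq_iff)

text \<open>An action on \<open>S \<times> \<int>\<close> commuting with the translations of \<open>\<int>\<close> is a homomorphism to the wreath
  product of \<open>\<int>\<close> with the symmetric group on \<open>S\<close>; the stabiliser of the fibre over \<open>s\<close> has finite index
  and translates this fibre, which gives a homomorphism to \<open>\<int>\<close>.\<close>

lemma (in group) virtual_retract_if_action_shift:
  fixes act :: "'a \<Rightarrow> 's \<times> int \<Rightarrow> 's \<times> int"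
  assumes one: "act \<one> = id"
    and mult: "\<And>x y. x \<in> carrier G \<Longrightarrow> y \<in> carrier G \<Longrightarrow> act (x \<otimes> y) = act x \<circ> act y"
    and fin: "finite S"
    and pres: "\<And>x s z. x \<in> carrier G \<Longrightarrow> s \<in> S \<Longrightarrow> fst (act x (s, z)) \<in> S"
    and shift: "\<And>x s z w. x \<in> carrier G \<Longrightarrow> s \<in> S \<Longrightarrow>
      act x (s, z + w) = (fst (act x (s, z)), snd (act x (s, z)) + w)"
    and g: "g \<in> carrier G" and s: "s \<in> S" and gs: "act g (s, 0) = (s, d)" and d: "d \<noteq> 0"
  shows "virtual_retract (generate G {g}) G"
proof -
  have sh: "act x (s', z + w) = (s'', z' + w)" if "act x (s', z) = (s'', z')" "x \<in> carrier G" "s' \<in> S"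
    for x s' s'' z z' w
    using shift[of x s' z w] that by simp
  have ai: "act (inv x) p = q" if "act x q = p" "x \<in> carrier G" for x p q
    using action_inv(1)[of act x q] one mult that by simp
  have npow: "act (g [^] n) (s, z) = (s, z + int n * d)" for n :: nat and z
  proof (induction n arbitrary: z)
    case 0
    then show ?case by (simp add: one)
  next
    case (Suc n)
    have "act (g [^] Suc n) (s, z) = act (g [^] n) (act g (s, 0 + z))"
      using g by (simp add: mult)
    also have "\<dots> = act (g [^] n) (s, d + z)"
      using sh[OF gs g s, of z] by simp
    finally show ?case
      using Suc by (simp add: algebra_simps)
  qed
  have pow: "act (g [^] j) (s, 0) = (s, j * d)" for j :: int
  proof (cases "j \<ge> 0")
    case True
    then show ?thesis
      using npow[of "nat j" 0] int_pow_int[of G g "nat j"] by simp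
  next
    case False
    then have j: "g [^] j = inv (g [^] nat (- j))"
      using int_pow_neg_int[OF g, of "nat (- j)"] by simp
    show ?thesis
      unfolding j using False g npow[of "nat (- j)" "j * d"] by (intro ai) (simp_all add: algebra_simps)
  qed
  define L where "L = {h \<in> carrier G. \<exists>j. act h (s, 0) = (s, j * d)}"
  have gen: "generate G {g} = range (\<lambda>j::int. g [^] j)"
    using generate_pow[OF g] by auto
  have L: "subgroup L G"
  proof (rule subgroupI)
    show "L \<subseteq> carrier G" by (auto simp: L_def)
    show "L \<noteq> {}" using one by (auto simp: L_def intro!: exI[of _ \<one>] exI[of _ 0])
    show "inv x \<in> L" if x: "x \<in> L" for x
    proof -
      obtain j where j: "x \<in> carrier G" "act x (s, 0) = (s, j * d)"
        using x by (auto simp: L_def)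
      have "act x (s, (- j) * d) = (s, 0)"
        using sh[OF j(2,1) s, of "- (j * d)"] by simp
      from ai[OF this j(1)] have "act (inv x) (s, 0) = (s, (- j) * d)" .
      then show ?thesis
        unfolding L_def using j(1) by blast
    qed
    show "x \<otimes> y \<in> L" if xy: "x \<in> L" "y \<in> L" for x y
    proof -
      obtain i j where ij: "x \<in> carrier G" "act x (s, 0) = (s, i * d)" "y \<in> carrier G" "act y (s, 0) = (s, j * d)"
        using xy by (auto simp: L_def)
      have "act (x \<otimes> y) (s, 0) = (s, (i + j) * d)"
        using ij sh[OF ij(2,1) s, of "j * d"] by (simp add: mult algebra_simps)
      then show ?thesis
        unfolding L_def using ij by blast
    qed
  qed
  \<comment> \<open>\<open>L\<close> is the stabiliser of the set of points
    \<open>(s, j * d)\<close>, so its right cosets are recorded by where inverses move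
    \<open>(s, 0)\<close>, with the integer coordinate taken modulo \<open>d\<close>.\<close>
  have "finite (rcosets L)"
  proof (rule finite_rcosets_if_finite_image[OF L,
        where f = "\<lambda>x. (fst (act (inv x) (s, 0)), snd (act (inv x) (s, 0)) mod \<bar>d\<bar>)"])
    show "finite ((\<lambda>x. (fst (act (inv x) (s, 0)), snd (act (inv x) (s, 0)) mod \<bar>d\<bar>)) ` carrier G)"
      by (rule finite_subset[of _ "S \<times> {0..<\<bar>d\<bar>}"]) (use fin pres s d in auto)
    fix x y assume xy: "x \<in> carrier G" "y \<in> carrier G"
      and eq: "(fst (act (inv x) (s, 0)), snd (act (inv x) (s, 0)) mod \<bar>d\<bar>)
        = (fst (act (inv y) (s, 0)), snd (act (inv y) (s, 0)) mod \<bar>d\<bar>)"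
    obtain s' z z' where z: "act (inv x) (s, 0) = (s', z)" "act (inv y) (s, 0) = (s', z')"
      using eq by (metis fst_conv prod.collapse)
    then have "\<bar>d\<bar> dvd z' - z"
      using eq by (metis mod_eq_dvd_iff prod.inject snd_conv)
    then have "d dvd z' - z" by simp
    then obtain j where "z' - z = d * j" by (elim dvdE)
    then have j: "z' = z + j * d" by (simp add: algebra_simps)
    have s': "s' \<in> S"
      using pres[of "inv x" s 0] xy z s by simp
    have "act x (s', z) = (s, 0)"
      using ai[OF z(1)] xy by simp
    then have "act (x \<otimes> inv y) (s, 0) = (s, j * d)"
      using sh[of x s' z s 0 "j * d"] s' xy z j by (simp add: mult)
    then show "x \<otimes> inv y \<in> L"
      using xy unfolding L_def by blast
  qed
  moreover have "(\<lambda>h. g [^] (snd (act h (s, 0)) div d)) \<in> hom (G\<lparr>carrier := L\<rparr>) (G\<lparr>carrier := generate G {g}\<rparr>)"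
  proof (rule homI)
    fix x y assume "x \<in> carrier (G\<lparr>carrier := L\<rparr>)" "y \<in> carrier (G\<lparr>carrier := L\<rparr>)"
    then obtain i j where ij: "x \<in> carrier G" "act x (s, 0) = (s, i * d)" "y \<in> carrier G" "act y (s, 0) = (s, j * d)"
      by (auto simp: L_def)
    have "act (x \<otimes> y) (s, 0) = (s, (i + j) * d)"
      using ij sh[OF ij(2,1) s, of "j * d"] by (simp add: mult algebra_simps)
    then show "g [^] (snd (act (x \<otimes>\<^bsub>G\<lparr>carrier := L\<rparr>\<^esub> y) (s, 0)) div d)
        = g [^] (snd (act x (s, 0)) div d) \<otimes>\<^bsub>G\<lparr>carrier := generate G {g}\<rparr>\<^esub> g [^] (snd (act y (s, 0)) div d)"
      using ij d g by (simp add: int_pow_mult)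
  qed (simp add: gen)
  moreover have "generate G {g} \<subseteq> L"
    using pow g by (auto simp: gen L_def)
  moreover have "\<forall>h\<in>generate G {g}. g [^] (snd (act h (s, 0)) div d) = h"
    using pow d by (simp add: gen)
  moreover have "subgroup (generate G {g}) G"
    using generate_is_subgroup g by simp
  ultimately show ?thesis
    unfolding virtual_retract_def using L
    by (intro conjI exI[of _ L] bexI[of _ "\<lambda>h. g [^] (snd (act h (s, 0)) div d)"])
qed

text \<open>The elements acting on \<open>S\<close> like some element of \<open>H\<close> form a
  subgroup \<open>L\<close>, of finite index because it contains the kernel of an action on a finite
  set. Faithfulness makes that element of \<open>H\<close> unique, and sending \<open>x\<close> to
  it is the retraction.\<close>

lemma (in group) virtual_retract_if_finite_action:
  assumes one: "\<And>s. s \<in> S \<Longrightarrow> act \<one> s = s"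
    and mult: "\<And>x y s. x \<in> carrier G \<Longrightarrow> y \<in> carrier G \<Longrightarrow> s \<in> S \<Longrightarrow> act (x \<otimes> y) s = act x (act y s)"
    and fin: "finite S"
    and pres: "\<And>x s. x \<in> carrier G \<Longrightarrow> s \<in> S \<Longrightarrow> act x s \<in> S"
    and H: "subgroup H G"
    and faithful: "\<And>h. h \<in> H \<Longrightarrow> (\<And>s. s \<in> S \<Longrightarrow> act h s = s) \<Longrightarrow> h = \<one>"
  shows "virtual_retract H G"
proof -
  have Hc: "h \<in> carrier G" if "h \<in> H" for h
    using subgroup.mem_carrier[OF H that] .
  have ai: "act (inv x) (act x s) = s" "act x (act (inv x) s) = s" if "x \<in> carrier G" "s \<in> S" for x s
    using mult[of "inv x" x s] mult[of x "inv x" s] that one by simp_all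
  have inj: "h = k" if "h \<in> H" "k \<in> H" "\<And>s. s \<in> S \<Longrightarrow> act h s = act k s" for h k
  proof -
    have "act (inv k \<otimes> h) s = s" if "s \<in> S" for s
      using that \<open>\<And>s. s \<in> S \<Longrightarrow> act h s = act k s\<close> Hc[OF \<open>h \<in> H\<close>] Hc[OF \<open>k \<in> H\<close>] by (simp add: mult ai)
    then have "inv k \<otimes> h = \<one>"
      using faithful[of "inv k \<otimes> h"] subgroup.m_closed[OF H subgroup.m_inv_closed[OF H that(2)] that(1)] by blast
    then show ?thesis
      using inv_unique'[of "inv k" h] Hc that by (metis inv_closed inv_inv inv_equality)
  qed
  define L where "L = {x \<in> carrier G. \<exists>h\<in>H. \<forall>s\<in>S. act x s = act h s}"
  define \<rho> where "\<rho> x = (THE h. h \<in> H \<and> (\<forall>s\<in>S. act x s = act h s))" for x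
  have \<rho>_eq: "\<rho> x = h" if "h \<in> H" "\<forall>s\<in>S. act x s = act h s" for x h
    unfolding \<rho>_def
  proof (rule the_equality)
    show "h \<in> H \<and> (\<forall>s\<in>S. act x s = act h s)" using that by blast
    show "k = h" if k: "k \<in> H \<and> (\<forall>s\<in>S. act x s = act k s)" for k
      using k \<open>h \<in> H\<close> \<open>\<forall>s\<in>S. act x s = act h s\<close> by (intro inj) auto
  qed
  have mulL: "x \<otimes> y \<in> carrier G \<and> h \<otimes> k \<in> H \<and> (\<forall>s\<in>S. act (x \<otimes> y) s = act (h \<otimes> k) s)"
    if "x \<in> carrier G" "y \<in> carrier G" "h \<in> H" "k \<in> H" "\<forall>s\<in>S. act x s = act h s" "\<forall>s\<in>S. act y s = act k s"
    for x y h k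
    using that Hc[OF that(3)] Hc[OF that(4)] subgroup.m_closed[OF H that(3,4)] pres by (simp add: mult)
  have L: "subgroup L G"
  proof (rule subgroupI)
    show "L \<subseteq> carrier G" by (auto simp: L_def)
    have "\<one> \<in> L" using subgroup.one_closed[OF H] by (auto simp: L_def)
    then show "L \<noteq> {}" by blast
    show "inv x \<in> L" if x: "x \<in> L" for x
    proof -
      obtain h where h: "x \<in> carrier G" "h \<in> H" "\<forall>s\<in>S. act x s = act h s"
        using x by (auto simp: L_def)
      have "act (inv x) s = act (inv h) s" if "s \<in> S" for s
      proof -
        have "act (inv x) s = act (inv x) (act h (act (inv h) s))"
          using ai that Hc[OF h(2)] by simp
        also have "\<dots> = act (inv x) (act x (act (inv h) s))"
          using h(3) pres[of "inv h" s] that Hc[OF h(2)] by simp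
        finally show ?thesis
          using ai(1)[of x "act (inv h) s"] h(1) pres[of "inv h" s] that Hc[OF h(2)] by simp
      qed
      then show ?thesis
        unfolding L_def using h(1) subgroup.m_inv_closed[OF H h(2)] by blast
    qed
    show "x \<otimes> y \<in> L" if "x \<in> L" "y \<in> L" for x y
      using that mulL unfolding L_def by blast
  qed
  have "finite (rcosets L)"
  proof (rule finite_rcosets_if_finite_image[OF L, where f = "\<lambda>x. restrict (act x) S"])
    show "finite ((\<lambda>x. restrict (act x) S) ` carrier G)"
      by (rule finite_subset[of _ "S \<rightarrow>\<^sub>E S"]) (use pres in \<open>auto intro: finite_PiE fin\<close>)
    fix x y assume xy: "x \<in> carrier G" "y \<in> carrier G" and eq: "restrict (act x) S = restrict (act y) S"
    have "act x s = act y s" if "s \<in> S" for s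
      using that eq by (metis restrict_apply')
    then have "act (x \<otimes> inv y) s = act \<one> s" if "s \<in> S" for s
      using that xy pres[of "inv y" s] ai(2)[of y s] by (simp add: mult one)
    then show "x \<otimes> inv y \<in> L"
      unfolding L_def using xy subgroup.one_closed[OF H] by blast
  qed
  moreover have "\<rho> \<in> hom (G\<lparr>carrier := L\<rparr>) (G\<lparr>carrier := H\<rparr>)"
  proof (rule homI)
    show "\<rho> x \<in> carrier (G\<lparr>carrier := H\<rparr>)" if "x \<in> carrier (G\<lparr>carrier := L\<rparr>)" for x
      using that \<rho>_eq by (auto simp: L_def)
    fix x y assume "x \<in> carrier (G\<lparr>carrier := L\<rparr>)" "y \<in> carrier (G\<lparr>carrier := L\<rparr>)"
    then obtain h k where hk: "x \<in> carrier G" "y \<in> carrier G" "h \<in> H" "k \<in> H"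
      "\<forall>s\<in>S. act x s = act h s" "\<forall>s\<in>S. act y s = act k s"
      by (auto simp: L_def)
    then show "\<rho> (x \<otimes>\<^bsub>G\<lparr>carrier := L\<rparr>\<^esub> y) = \<rho> x \<otimes>\<^bsub>G\<lparr>carrier := H\<rparr>\<^esub> \<rho> y"
      using mulL[OF hk] \<rho>_eq[of h x] \<rho>_eq[of k y] \<rho>_eq[of "h \<otimes> k" "x \<otimes> y"] by simp
  qed
  moreover have "H \<subseteq> L"
    using Hc by (auto simp: L_def)
  moreover have "\<forall>h\<in>H. \<rho> h = h"
    using \<rho>_eq by blast
  ultimately show ?thesis
    unfolding virtual_retract_def using H L by (intro conjI exI[of _ L] bexI[of _ \<rho>])
qed

section \<open>Extending equivariant partial bijections\<close>

text \<open>A triple \<open>(p, q, v)\<close> in \<open>E\<close> prescribes \<open>\<tau> p = q\<close> together with the label \<open>v\<close> of the \<open>\<alpha>\<close>-orbit of \<open>p\<close>.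
  The graph of \<open>\<tau>\<close> is built orbit by orbit; \<open>\<alpha>\<close> and \<open>\<beta>\<close> always miss equally many points.\<close>

lemma equivariant_bijection_extension:
  fixes \<alpha> \<beta> :: "'s \<Rightarrow> 's" and E :: "('s \<times> 's \<times> 'v) set"
  assumes fin: "finite S"
    and \<alpha>S: "\<And>p. p \<in> S \<Longrightarrow> \<alpha> p \<in> S" and \<beta>S: "\<And>p. p \<in> S \<Longrightarrow> \<beta> p \<in> S"
    and n: "n > 0" and per: "\<And>p. p \<in> S \<Longrightarrow> (\<alpha> ^^ n) p = p" "\<And>p. p \<in> S \<Longrightarrow> (\<beta> ^^ n) p = p"
    and sync: "\<And>p q i j. p \<in> S \<Longrightarrow> q \<in> S \<Longrightarrow> (\<alpha> ^^ i) p = (\<alpha> ^^ j) p \<longleftrightarrow> (\<beta> ^^ i) q = (\<beta> ^^ j) q"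
    and E: "\<And>p q v. (p, q, v) \<in> E \<Longrightarrow> p \<in> S \<and> q \<in> S"
    and disj: "\<And>p q v p' q' v' i j. (p, q, v) \<in> E \<Longrightarrow> (p', q', v') \<in> E \<Longrightarrow> (p, q, v) \<noteq> (p', q', v') \<Longrightarrow>
      (\<alpha> ^^ i) p \<noteq> (\<alpha> ^^ j) p' \<and> (\<beta> ^^ i) q \<noteq> (\<beta> ^^ j) q'"
  shows "\<exists>\<tau> w. bij_betw \<tau> S S \<and> (\<forall>p\<in>S. \<tau> (\<alpha> p) = \<beta> (\<tau> p) \<and> w (\<alpha> p) = w p) \<and>
    (\<forall>(p, q, v)\<in>E. \<tau> p = q \<and> w p = v)"
proof -
  \<comment> \<open>A good \<open>R\<close> is the graph of a labelled partial bijection, closed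
    under applying \<alpha> and \<beta> simultaneously.\<close>
  define good where "good R \<longleftrightarrow>
    (\<forall>p q v. (p, q, v) \<in> R \<longrightarrow> p \<in> S \<and> q \<in> S \<and> (\<alpha> p, \<beta> q, v) \<in> R) \<and>
    (\<forall>p q v p' q' v'. (p, q, v) \<in> R \<longrightarrow> (p', q', v') \<in> R \<longrightarrow> (p = p' \<longleftrightarrow> q = q') \<and> (p = p' \<longrightarrow> v = v'))"
    for R :: "('s \<times> 's \<times> 'v) set"
  define orb where "orb p q v = range (\<lambda>i. ((\<alpha> ^^ i) p, (\<beta> ^^ i) q, v))" for p q and v :: 'v
  have pwS: "(\<alpha> ^^ i) p \<in> S" "(\<beta> ^^ i) p \<in> S" if "p \<in> S" for i p
    using that by (induction i) (auto intro: \<alpha>S \<beta>S)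
  have pern: "(\<alpha> ^^ (n * i)) p = p" "(\<beta> ^^ (n * i)) p = p" if "p \<in> S" for i p
    using that per by (induction i) (simp_all add: funpow_add)
  have orbS: "p' \<in> S \<and> q' \<in> S \<and> (\<alpha> p', \<beta> q', v') \<in> orb p q v"
    if o: "(p', q', v') \<in> orb p q v" and pq: "p \<in> S" "q \<in> S" for p q v p' q' v'
  proof -
    obtain i where i: "p' = (\<alpha> ^^ i) p" "q' = (\<beta> ^^ i) q" "v' = v"
      using o by (auto simp: orb_def)
    have "(\<alpha> p', \<beta> q', v') = ((\<alpha> ^^ Suc i) p, (\<beta> ^^ Suc i) q, v)"
      by (simp add: i)
    then show ?thesis
      using i pwS pq unfolding orb_def by blast
  qed
  have extend: "\<exists>R'. good R' \<and> R \<subseteq> R' \<and> fst ` R' = S" if "good R" for R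
    using that
  proof (induction "card (S - fst ` R)" arbitrary: R rule: less_induct)
    case less
    have cl: "(p, q, v) \<in> R \<Longrightarrow> p \<in> S \<and> q \<in> S \<and> (\<alpha> p, \<beta> q, v) \<in> R" for p q v
      using less.prems unfolding good_def by blast
    have co: "(p, q, v) \<in> R \<Longrightarrow> (p', q', v') \<in> R \<Longrightarrow> (p = p' \<longleftrightarrow> q = q') \<and> (p = p' \<longrightarrow> v = v')"
      for p q v p' q' v'
      using less.prems unfolding good_def by blast
    have clp: "((\<alpha> ^^ i) p, (\<beta> ^^ i) q, v) \<in> R" if "(p, q, v) \<in> R" for i p q v
      using that by (induction i) (auto simp: cl)
    show ?case
    proof (cases "fst ` R = S")
      case True
      then show ?thesis using less.prems by blast
    next
      case False
      let ?R2 = "(\<lambda>(p, q, v). (p, q)) ` R"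
      have RS: "fst ` R \<subseteq> S" "fst ` ?R2 = fst ` R" "snd ` ?R2 \<subseteq> S"
        using cl by (force simp: image_image)+
      have "inj_on fst ?R2" "inj_on snd ?R2"
        using co by (auto simp: inj_on_def)
      \<comment> \<open>A partial bijection of the finite set \<open>S\<close> that misses a source
        also misses a target.\<close>
      then have "card (snd ` ?R2) = card (fst ` R)"
        using card_image RS(2) by metis
      also have "\<dots> < card S"
        using False RS(1) fin by (simp add: psubset_card_mono psubset_eq)
      finally have "snd ` ?R2 \<noteq> S" by blast
      then obtain p q where pq: "p \<in> S" "p \<notin> fst ` R" "q \<in> S" "q \<notin> snd ` ?R2"
        using False RS by blast
      \<comment> \<open>The new orbits are disjoint from \<open>R\<close>, so any label will
        do.\<close>
      let ?R' = "R \<union> orb p q undefined"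
      have new: "(\<alpha> ^^ i) p \<noteq> p' \<and> (\<beta> ^^ i) q \<noteq> q'" if "(p', q', v') \<in> R" for p' q' v' i
      proof -
        \<comment> \<open>As \<open>n\<close> is positive, \<open>n * i - i\<close> further steps
          undo the first \<open>i\<close>; an orbit meeting \<open>R\<close> would therefore bring
          \<open>p\<close> or \<open>q\<close> itself into \<open>R\<close>.\<close>
        have "n * i - i + i = n * i" using n by simp
        then have ret: "(\<alpha> ^^ (n * i - i)) ((\<alpha> ^^ i) p) = p" "(\<beta> ^^ (n * i - i)) ((\<beta> ^^ i) q) = q"
          using pern pq by (metis comp_apply funpow_add)+
        have "(\<alpha> ^^ (n * i - i)) p' \<in> fst ` R" "(\<beta> ^^ (n * i - i)) q' \<in> snd ` ?R2"
          using clp[OF that, of "n * i - i"] by (force simp: image_image)+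
        then show ?thesis using ret pq by metis
      qed
      have "good ?R'"
        unfolding good_def
      proof (intro conjI allI impI)
        fix p1 q1 v1 assume "(p1, q1, v1) \<in> ?R'"
        then show "p1 \<in> S" "q1 \<in> S" "(\<alpha> p1, \<beta> q1, v1) \<in> ?R'"
          using cl orbS pq by blast+
      next
        fix p1 q1 v1 p2 q2 v2 assume 1: "(p1, q1, v1) \<in> ?R'" and 2: "(p2, q2, v2) \<in> ?R'"
        have "(p1 = p2 \<longleftrightarrow> q1 = q2) \<and> (p1 = p2 \<longrightarrow> v1 = v2)"
          using 1 2 co[of p1 q1 v1 p2 q2 v2] new sync[OF pq(1,3)]
          by (auto simp: orb_def)
        then show "p1 = p2 \<longleftrightarrow> q1 = q2" "p1 = p2 \<Longrightarrow> v1 = v2" by blast+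
      qed
      moreover have "card (S - fst ` ?R') < card (S - fst ` R)"
      proof (rule psubset_card_mono)
        have "(p, q, undefined) \<in> orb p q undefined"
          unfolding orb_def by (rule range_eqI[of _ _ 0]) simp
        then have "p \<in> fst ` ?R'" by force
        then show "S - fst ` ?R' \<subset> S - fst ` R" using pq by blast
      qed (use fin in simp)
      ultimately obtain R' where "good R'" "?R' \<subseteq> R'" "fst ` R' = S"
        using less.hyps[of ?R'] by blast
      then show ?thesis by blast
    qed
  qed
  \<comment> \<open>Consistency within one prescribed orbit comes from \<open>sync\<close>, between
    different ones from \<open>disj\<close>.\<close>
  have "good (\<Union>(p, q, v)\<in>E. orb p q v)"
    unfolding good_def
  proof (intro conjI allI impI)
    fix p1 q1 v1 assume "(p1, q1, v1) \<in> (\<Union>(p, q, v)\<in>E. orb p q v)"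
    then obtain p q v where e: "(p, q, v) \<in> E" "(p1, q1, v1) \<in> orb p q v" by blast
    then show "p1 \<in> S" "q1 \<in> S" "(\<alpha> p1, \<beta> q1, v1) \<in> (\<Union>(p, q, v)\<in>E. orb p q v)"
      using orbS[OF e(2)] E[OF e(1)] by blast+
  next
    fix p1 q1 v1 p2 q2 v2
    assume 1: "(p1, q1, v1) \<in> (\<Union>(p, q, v)\<in>E. orb p q v)" and 2: "(p2, q2, v2) \<in> (\<Union>(p, q, v)\<in>E. orb p q v)"
    obtain p q v where e: "(p, q, v) \<in> E" "(p1, q1, v1) \<in> orb p q v" using 1 by blast
    obtain p' q' v' where e': "(p', q', v') \<in> E" "(p2, q2, v2) \<in> orb p' q' v'" using 2 by blast
    obtain i where i: "p1 = (\<alpha> ^^ i) p" "q1 = (\<beta> ^^ i) q" "v1 = v"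
      using e(2) by (auto simp: orb_def)
    obtain j where j: "p2 = (\<alpha> ^^ j) p'" "q2 = (\<beta> ^^ j) q'" "v2 = v'"
      using e'(2) by (auto simp: orb_def)
    have "(p1 = p2 \<longleftrightarrow> q1 = q2) \<and> (p1 = p2 \<longrightarrow> v1 = v2)"
    proof (cases "(p, q, v) = (p', q', v')")
      case True
      then show ?thesis using i j sync E[OF e(1)] by auto
    next
      case False
      then show ?thesis using i j disj[OF e(1) e'(1) False] by auto
    qed
    then show "p1 = p2 \<longleftrightarrow> q1 = q2" "p1 = p2 \<Longrightarrow> v1 = v2" by blast+
  qed
  then obtain R where R: "good R" "(\<Union>(p, q, v)\<in>E. orb p q v) \<subseteq> R" "fst ` R = S"
    using extend by blast
  have cl: "(p, q, v) \<in> R \<Longrightarrow> p \<in> S \<and> q \<in> S \<and> (\<alpha> p, \<beta> q, v) \<in> R" for p q v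
    using R(1) unfolding good_def by blast
  have co: "(p, q, v) \<in> R \<Longrightarrow> (p', q', v') \<in> R \<Longrightarrow> (p = p' \<longleftrightarrow> q = q') \<and> (p = p' \<longrightarrow> v = v')"
    for p q v p' q' v'
    using R(1) unfolding good_def by blast
  have "\<forall>p\<in>S. \<exists>q v. (p, q, v) \<in> R"
    using R(3) by force
  then obtain \<tau> w where tw: "\<And>p. p \<in> S \<Longrightarrow> (p, \<tau> p, w p) \<in> R" by metis
  have tw_eq: "\<tau> p = q \<and> w p = v" if "(p, q, v) \<in> R" for p q v
    using co[OF tw[of p] that] cl[OF that] by blast
  have "inj_on \<tau> S"
    using tw co by (meson inj_onI)
  moreover have "\<tau> ` S \<subseteq> S"
    using tw cl by blast
  ultimately have "bij_betw \<tau> S S"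
    using fin by (simp add: bij_betw_def endo_inj_surj)
  moreover have "\<forall>p\<in>S. \<tau> (\<alpha> p) = \<beta> (\<tau> p) \<and> w (\<alpha> p) = w p"
    using tw cl tw_eq by blast
  moreover have "(p, q, v) \<in> R" if "(p, q, v) \<in> E" for p q v
  proof -
    have "(p, q, v) \<in> orb p q v"
      unfolding orb_def by (rule range_eqI[of _ _ 0]) simp
    then show ?thesis using R(2) that by blast
  qed
  ultimately show ?thesis
    using tw_eq by (intro exI[of _ \<tau>] exI[of _ w]) blast
qed

section \<open>Actions of presented groups\<close>

lemma presented_group_carrierE:
  assumes "g \<in> carrier (presented_group X R)"
  obtains w where "w \<in> words X" "g = pres_rel X R `` {w}"
  using assms by (auto simp: presented_group_def elim: quotientE)

lemma presented_group_class_closed: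
  "w \<in> words X \<Longrightarrow> pres_rel X R `` {w} \<in> carrier (presented_group X R)"
  by (auto simp: presented_group_def intro: quotientI)

lemma presented_group_one: "\<one>\<^bsub>presented_group X R\<^esub> = pres_rel X R `` {[]}"
  by (simp add: presented_group_def)

lemma presented_group_class_eq:
  "(u, v) \<in> pres_rel X R \<Longrightarrow> pres_rel X R `` {u} = pres_rel X R `` {v}"
  using equiv_class_eq[OF equiv_pres_rel] .

lemma presented_group_inv_letter:
  assumes "x \<in> X"
  shows "inv\<^bsub>presented_group X R\<^esub> (pres_rel X R `` {[(x, True)]}) = pres_rel X R `` {[(x, False)]}"
proof -
  interpret group "presented_group X R" by (rule group_presented_group)
  have w: "[(x, e)] \<in> words X" for e
    using assms by (simp add: words_def)
  show ?thesis
    using pres_rel.cancel[OF assms, of False R] presented_group_class_eq w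
    by (intro inv_equality)
      (simp_all add: presented_group_mult presented_group_one presented_group_class_closed)
qed

text \<open>Von Dyck's theorem for actions: evaluating words letter by letter respects every rule
  generating \<open>pres_rel\<close>, so the value does not depend on the representative. In
  \<open>foldr\<close> the last letter acts first, as in a composition of maps.\<close>

lemma presented_group_action:
  fixes F :: "'x \<Rightarrow> bool \<Rightarrow> 'p \<Rightarrow> 'p"
  assumes inv: "\<And>x e. x \<in> X \<Longrightarrow> F x e \<circ> F x (\<not> e) = id"
    and rel: "\<And>r. r \<in> R \<Longrightarrow> r \<in> words X \<Longrightarrow> foldr (\<lambda>(x, e) h. F x e \<circ> h) r id = id"
  shows "\<exists>act. act \<one>\<^bsub>presented_group X R\<^esub> = id \<and>
    (\<forall>g\<in>carrier (presented_group X R). \<forall>h\<in>carrier (presented_group X R).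
      act (g \<otimes>\<^bsub>presented_group X R\<^esub> h) = act g \<circ> act h) \<and>
    (\<forall>x\<in>X. \<forall>e. act (pres_rel X R `` {[(x, e)]}) = F x e)"
proof -
  define ev where "ev w = foldr (\<lambda>(x, e) h. F x e \<circ> h) w id" for w
  have ev_append: "ev (u @ v) = ev u \<circ> ev v" for u v
    unfolding ev_def by (induction u) (auto simp: fun_eq_iff)
  have ev_rel: "ev u = ev v" if "(u, v) \<in> pres_rel X R" for u v
    using that
  proof (induction rule: pres_rel.induct)
    case (cancel x e)
    then show ?case using inv[of x e] by (simp add: ev_def)
  next
    case (relator r)
    then show ?case using rel[of r] by (simp add: ev_def)
  qed (simp_all add: ev_append)
  define act where "act U = ev (SOME u. u \<in> U)" for U
  have act: "act (pres_rel X R `` {w}) = ev w" if w: "w \<in> words X" for w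
  proof -
    have "w \<in> pres_rel X R `` {w}"
      using pres_rel.refl[OF w] by simp
    then have "(SOME u. u \<in> pres_rel X R `` {w}) \<in> pres_rel X R `` {w}"
      by (rule someI)
    then show ?thesis
      unfolding act_def using ev_rel by (metis Image_singleton_iff)
  qed
  have "act (g \<otimes>\<^bsub>presented_group X R\<^esub> h) = act g \<circ> act h"
    if "g \<in> carrier (presented_group X R)" "h \<in> carrier (presented_group X R)" for g h
    using that
    by (elim presented_group_carrierE) (simp add: presented_group_mult act words_append ev_append)
  moreover have "act \<one>\<^bsub>presented_group X R\<^esub> = id"
    unfolding presented_group_one by (subst act) (simp_all add: words_def ev_def)
  moreover have "act (pres_rel X R `` {[(x, e)]}) = F x e" if "x \<in> X" for x e
    using that by (subst act) (simp_all add: words_def ev_def)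
  ultimately show ?thesis by blast
qed

section \<open>The HNN-extension\<close>

locale hnn = A: comm_group A for A :: "('a, 'm) monoid_scheme" (structure) +
  fixes a b :: 'a
  assumes a: "a \<in> carrier A" and b: "b \<in> carrier A"
begin

abbreviation gens :: "'a option set" where
  "gens \<equiv> insert None (Some ` carrier A)"

abbreviation rels :: "'a option word set" where
  "rels \<equiv> hnn_relators A a b"

definition G :: "'a option word set monoid" where
  "G = hnn_extension A a b"

definition base :: "'a \<Rightarrow> 'a option word set" where
  "base x = pres_rel gens rels `` {[(Some x, True)]}"

definition stable :: "'a option word set" where
  "stable = pres_rel gens rels `` {[(None, True)]}"

lemma G_eq: "G = presented_group gens rels"
  by (simp add: G_def hnn_extension_def)

sublocale G: group G
  unfolding G_eq by (rule group_presented_group)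

lemma base_closed [simp]: "x \<in> carrier A \<Longrightarrow> base x \<in> carrier G"
  unfolding G_eq base_def by (rule presented_group_class_closed) (simp add: words_def)

lemma stable_closed [simp]: "stable \<in> carrier G"
  unfolding G_eq stable_def by (rule presented_group_class_closed) (simp add: words_def)

lemma base_inv: "x \<in> carrier A \<Longrightarrow> inv\<^bsub>G\<^esub> (base x) = pres_rel gens rels `` {[(Some x, False)]}"
  unfolding G_eq base_def by (rule presented_group_inv_letter) simp

lemma stable_inv: "inv\<^bsub>G\<^esub> stable = pres_rel gens rels `` {[(None, False)]}"
  unfolding G_eq stable_def by (rule presented_group_inv_letter) simp

lemma base_mult:
  assumes x: "x \<in> carrier A" and y: "y \<in> carrier A"
  shows "base (x \<otimes> y) = base x \<otimes>\<^bsub>G\<^esub> base y"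
proof -
  let ?r = "[(Some x, True), (Some y, True), (Some (x \<otimes> y), False)]"
  have w: "?r \<in> words gens" using x y by (simp add: words_def)
  have "?r \<in> rels" using x y by (auto simp: hnn_relators_def)
  then have "pres_rel gens rels `` {?r} = \<one>\<^bsub>G\<^esub>"
    using pres_rel.relator[OF _ w] presented_group_class_eq
    unfolding G_eq presented_group_one by metis
  moreover have "pres_rel gens rels `` {?r} = base x \<otimes>\<^bsub>G\<^esub> (base y \<otimes>\<^bsub>G\<^esub> inv\<^bsub>G\<^esub> (base (x \<otimes> y)))"
    using x y unfolding base_inv[OF A.m_closed[OF x y]] unfolding G_eq base_def
    by (simp add: presented_group_mult words_def)
  ultimately show ?thesis
    using x y G.inv_equality[of "base x \<otimes>\<^bsub>G\<^esub> base y" "inv\<^bsub>G\<^esub> (base (x \<otimes> y))"]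
    by (simp add: G.m_assoc)
qed

sublocale base: group_hom A G base
  by unfold_locales (simp add: hom_def base_mult)

lemma stable_conj: "stable \<otimes>\<^bsub>G\<^esub> base a \<otimes>\<^bsub>G\<^esub> inv\<^bsub>G\<^esub> stable = base b"
proof -
  let ?r = "[(None, True), (Some a, True), (None, False), (Some b, False)]"
  have w: "?r \<in> words gens" using a b by (simp add: words_def)
  have "?r \<in> rels" by (simp add: hnn_relators_def)
  then have "pres_rel gens rels `` {?r} = \<one>\<^bsub>G\<^esub>"
    using pres_rel.relator[OF _ w] presented_group_class_eq
    unfolding G_eq presented_group_one by metis
  moreover have "pres_rel gens rels `` {?r} = stable \<otimes>\<^bsub>G\<^esub> base a \<otimes>\<^bsub>G\<^esub> inv\<^bsub>G\<^esub> stable \<otimes>\<^bsub>G\<^esub> inv\<^bsub>G\<^esub> (base b)"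
    using a b unfolding base_inv[OF b] stable_inv unfolding G_eq base_def stable_def
    by (simp add: presented_group_mult words_def)
  ultimately show ?thesis
    using a b G.inv_equality[of "stable \<otimes>\<^bsub>G\<^esub> base a \<otimes>\<^bsub>G\<^esub> inv\<^bsub>G\<^esub> stable" "inv\<^bsub>G\<^esub> (base b)"]
    by simp
qed

lemma stable_conj_pow:
  "stable \<otimes>\<^bsub>G\<^esub> base (a [^] (j::int)) \<otimes>\<^bsub>G\<^esub> inv\<^bsub>G\<^esub> stable = base (b [^] j)"
  using G.conj_int_pow[of stable "base a" j] a b by (simp add: base.hom_int_pow stable_conj)

text \<open>Induction on a word representing \<open>g\<close>, peeling off letters on the left.
  Inverse letters from \<open>A\<close> fall under the \<open>base\<close> case, since
  \<open>base\<close> maps inverses to inverses.\<close>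

lemma G_induct [consumes 1, case_names one base stable stable_inv]:
  assumes "g \<in> carrier G"
    and one: "P \<one>\<^bsub>G\<^esub>"
    and 1: "\<And>x g. x \<in> carrier A \<Longrightarrow> g \<in> carrier G \<Longrightarrow> P g \<Longrightarrow> P (base x \<otimes>\<^bsub>G\<^esub> g)"
    and 2: "\<And>g. g \<in> carrier G \<Longrightarrow> P g \<Longrightarrow> P (stable \<otimes>\<^bsub>G\<^esub> g)"
    and 3: "\<And>g. g \<in> carrier G \<Longrightarrow> P g \<Longrightarrow> P (inv\<^bsub>G\<^esub> stable \<otimes>\<^bsub>G\<^esub> g)"
  shows "P g"
proof -
  obtain w where w: "w \<in> words gens" "g = pres_rel gens rels `` {w}"
    using assms(1) unfolding G_eq by (elim presented_group_carrierE)
  have "P (pres_rel gens rels `` {w})"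
    using w(1)
  proof (induction w)
    case Nil
    show ?case using one unfolding G_eq presented_group_one .
  next
    case (Cons l w)
    obtain x e where l: "l = (x, e)" by fastforce
    have x: "x \<in> gens" and w: "w \<in> words gens" "[(x, e)] \<in> words gens"
      using Cons.prems l by (auto simp: words_def)
    have c: "pres_rel gens rels `` {w} \<in> carrier G"
      unfolding G_eq using presented_group_class_closed[OF w(1)] .
    have IH: "P (pres_rel gens rels `` {w})"
      using Cons.IH w by blast
    have split: "pres_rel gens rels `` {l # w} = pres_rel gens rels `` {[(x, e)]} \<otimes>\<^bsub>G\<^esub> pres_rel gens rels `` {w}"
      unfolding G_eq l using w by (simp add: presented_group_mult)
    show ?case
    proof (cases x)
      case None
      then show ?thesis
        using split 2[OF c IH] 3[OF c IH] stable_def stable_inv by (cases e) simp_all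
    next
      case (Some y)
      then have y: "y \<in> carrier A" using x by auto
      have "base (inv y) = inv\<^bsub>G\<^esub> (base y)"
        using y by simp
      then show ?thesis
        using Some split 1[OF y c IH] 1[of "inv y", OF _ c IH] y base_def base_inv[OF y]
        by (cases e) simp_all
    qed
  qed
  then show ?thesis using w by simp
qed

text \<open>The relators act trivially: those of the multiplication table because \<open>f\<close>
  is an action, the remaining one because \<open>T\<close> conjugates \<open>f a\<close> to
  \<open>f b\<close>. The freedom in choosing \<open>T\<close> is exploited below.\<close>

lemma G_action:
  fixes f :: "'a \<Rightarrow> 'p \<Rightarrow> 'p"
  assumes f: "\<And>x y. x \<in> carrier A \<Longrightarrow> y \<in> carrier A \<Longrightarrow> f (x \<otimes> y) = f x \<circ> f y" "f \<one> = id"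
    and T: "T \<circ> T' = id" "T' \<circ> T = id" "T \<circ> f a = f b \<circ> T"
  shows "\<exists>act. act \<one>\<^bsub>G\<^esub> = id \<and>
    (\<forall>g\<in>carrier G. \<forall>h\<in>carrier G. act (g \<otimes>\<^bsub>G\<^esub> h) = act g \<circ> act h) \<and>
    (\<forall>x\<in>carrier A. act (base x) = f x) \<and> act stable = T \<and> act (inv\<^bsub>G\<^esub> stable) = T'"
proof -
  define F where "F x e = (case x of None \<Rightarrow> if e then T else T' | Some y \<Rightarrow> if e then f y else f (inv y))" for x e
  have finv: "f x \<circ> f (inv x) = id" "f (inv x) \<circ> f x = id" if "x \<in> carrier A" for x
    using f(1)[of x "inv x"] f(1)[of "inv x" x] f(2) that by simp_all
  have "\<exists>act. act \<one>\<^bsub>presented_group gens rels\<^esub> = id \<and>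
    (\<forall>g\<in>carrier (presented_group gens rels). \<forall>h\<in>carrier (presented_group gens rels).
      act (g \<otimes>\<^bsub>presented_group gens rels\<^esub> h) = act g \<circ> act h) \<and>
    (\<forall>x\<in>gens. \<forall>e. act (pres_rel gens rels `` {[(x, e)]}) = F x e)"
  proof (rule presented_group_action)
    show "F x e \<circ> F x (\<not> e) = id" if "x \<in> gens" for x e
      using that T finv by (cases e) (auto simp: F_def)
    show "foldr (\<lambda>(x, e) h. F x e \<circ> h) r id = id" if r: "r \<in> rels" for r
    proof -
      consider x y where "x \<in> carrier A" "y \<in> carrier A" "r = [(Some x, True), (Some y, True), (Some (x \<otimes> y), False)]"
        | "r = [(None, True), (Some a, True), (None, False), (Some b, False)]"
        using r by (auto simp: hnn_relators_def)
      then show ?thesis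
      proof cases
        case 1
        then have "foldr (\<lambda>(x, e) h. F x e \<circ> h) r id = f (x \<otimes> y) \<circ> f (inv (x \<otimes> y))"
          using f(1)[of x y] by (simp add: F_def o_assoc)
        then show ?thesis using finv(1)[of "x \<otimes> y"] 1 by simp
      next
        case 2
        then have "foldr (\<lambda>(x, e) h. F x e \<circ> h) r id = (T \<circ> f a) \<circ> T' \<circ> f (inv b)"
          by (simp add: F_def o_assoc)
        also have "\<dots> = f b \<circ> (T \<circ> T') \<circ> f (inv b)"
          by (simp only: T(3) o_assoc)
        finally show ?thesis using T(1) finv(1)[OF b] by simp
      qed
    qed
  qed
  then obtain act where act: "act \<one>\<^bsub>G\<^esub> = id"
    "\<forall>g\<in>carrier G. \<forall>h\<in>carrier G. act (g \<otimes>\<^bsub>G\<^esub> h) = act g \<circ> act h"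
    and F: "\<And>x e. x \<in> gens \<Longrightarrow> act (pres_rel gens rels `` {[(x, e)]}) = F x e"
    unfolding G_eq by blast
  have "act (base x) = f x" if "x \<in> carrier A" for x
    using F[of "Some x" True] that by (simp add: base_def F_def)
  moreover have "act stable = T" "act (inv\<^bsub>G\<^esub> stable) = T'"
    using F[of None] unfolding stable_inv by (simp_all add: stable_def F_def)
  ultimately show ?thesis
    using act by blast
qed

end

section \<open>Balanced HNN-extensions\<close>

lemma (in group) hom_integer_pow:
  assumes "\<phi> \<in> hom G integer_group" "x \<in> carrier G"
  shows "\<phi> (x [^] (k::int)) = k * \<phi> x"
  using hom_int_pow[OF assms is_group group_integer_group, of k] by simp

definition (in comm_group) hnn_condition :: "'a \<Rightarrow> 'a \<Rightarrow> bool" where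
  "hnn_condition a b \<longleftrightarrow>
     generate G {a} \<inter> generate G {b} = {\<one>} \<or>
     (\<exists>m::nat. m > 0 \<and> (b [^] m = a [^] m \<or> b [^] m = a [^] (- int m)))"

lemma (in group) ord_eq_0_int:
  assumes "x \<in> carrier G"
  shows "ord x = 0 \<longleftrightarrow> (\<forall>k::int. x [^] k = \<one> \<longrightarrow> k = 0)"
  using int_pow_eq_id[OF assms] by (metis dvd_0_left_iff dvd_refl of_nat_eq_0_iff)

context hnn
begin

text \<open>\<open>G\<close> acts on the real line, \<open>A\<close> by the translations \<open>\<phi>\<close> and \<open>t\<close> by the factor \<open>\<phi> b / \<phi> a\<close>.\<close>

lemma ord_base_eq_0:
  assumes \<phi>: "\<phi> \<in> hom A integer_group" and "\<phi> a \<noteq> 0" "\<phi> b \<noteq> 0"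
  shows "G.ord (base a) = 0"
proof -
  define c :: real where "c = \<phi> b / \<phi> a"
  have c: "c \<noteq> 0" "c * \<phi> a = \<phi> b"
    using assms by (simp_all add: c_def)
  define f where "f x r = r + real_of_int (\<phi> x)" for x r
  have "f (x \<otimes> y) = f x \<circ> f y" if "x \<in> carrier A" "y \<in> carrier A" for x y
    using hom_mult[OF \<phi> that] by (simp add: fun_eq_iff f_def)
  moreover have "f \<one> = id"
    using hom_one[OF \<phi> A.is_group group_integer_group] by (simp add: fun_eq_iff f_def)
  moreover have "(\<lambda>r. c * r) \<circ> f a = f b \<circ> (\<lambda>r. c * r)"
    using c by (simp add: fun_eq_iff f_def algebra_simps)
  moreover have "(\<lambda>r. c * r) \<circ> (\<lambda>r. r / c) = id" "(\<lambda>r. r / c) \<circ> (\<lambda>r. c * r) = id"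
    using c by (simp_all add: fun_eq_iff)
  ultimately obtain act where act: "act \<one>\<^bsub>G\<^esub> = id" "\<And>x. x \<in> carrier A \<Longrightarrow> act (base x) = f x"
    using G_action[of f "\<lambda>r. c * r" "\<lambda>r. r / c"] by blast
  have "k = 0" if "base a [^]\<^bsub>G\<^esub> k = \<one>\<^bsub>G\<^esub>" for k :: int
  proof -
    have "base (a [^] k) = \<one>\<^bsub>G\<^esub>"
      using that a by (simp add: base.hom_int_pow)
    then have "f (a [^] k) 0 = 0"
      using act a by (metis A.int_pow_closed id_apply)
    then have "real_of_int (\<phi> (a [^] k)) = 0"
      by (simp add: f_def)
    then have "\<phi> (a [^] k) = 0"
      by simp
    then show ?thesis
      using A.hom_integer_pow[OF \<phi> a, of k] \<open>\<phi> a \<noteq> 0\<close> by simp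
  qed
  then show ?thesis
    using G.ord_eq_0_int[OF base_closed[OF a]] by blast
qed

lemma balanced_imp_hnn_condition:
  assumes fg: "finitely_generated_group A" and ord: "A.ord a = A.ord b" and bal: "balanced G"
  shows "A.hnn_condition a b"
proof (cases "generate A {a} \<inter> generate A {b} = {\<one>}")
  case True
  then show ?thesis by (simp add: A.hnn_condition_def)
next
  case False
  moreover have "\<one> \<in> generate A {a} \<inter> generate A {b}"
    by (simp add: generate.one)
  ultimately obtain y where y: "y \<in> generate A {a}" "y \<in> generate A {b}" "y \<noteq> \<one>" by blast
  obtain k :: int where k: "y = a [^] k"
    using y(1) A.generate_pow[OF a] by blast
  obtain l :: int where l: "y = b [^] l"
    using y(2) A.generate_pow[OF b] by blast
  have kl: "k \<noteq> 0" "l \<noteq> 0"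
    using y(3) k l by auto
  show ?thesis
  proof (cases "A.ord a = 0")
    case False
    \<comment> \<open>Both sides are trivial, the two orders being equal.\<close>
    have "b [^] A.ord a = a [^] A.ord a"
      using a b ord by (metis A.pow_ord_eq_1)
    then show ?thesis
      using False by (auto simp: A.hnn_condition_def)
  next
    case True
    have "i = 0" if "a [^] (i::int) \<in> {\<one>}" for i
      using that True A.ord_eq_0_int[OF a] by blast
    then obtain \<phi> where \<phi>: "\<phi> \<in> hom A integer_group" "\<phi> a \<noteq> 0"
      using A.separating_hom_int[OF fg A.triv_subgroup a] by blast
    \<comment> \<open>Applying \<phi> to \<open>a^k = b^l\<close> shows that \<phi> does not vanish
      on \<open>b\<close> either.\<close>
    have "k * \<phi> a = l * \<phi> b"
      using A.hom_integer_pow[OF \<phi>(1)] a b k l by metis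
    then have "\<phi> b \<noteq> 0"
      using kl \<phi>(2) by auto
    then have "G.ord (base a) = 0"
      using ord_base_eq_0 \<phi> by blast
    moreover have "stable \<otimes>\<^bsub>G\<^esub> (base a [^]\<^bsub>G\<^esub> l) \<otimes>\<^bsub>G\<^esub> inv\<^bsub>G\<^esub> stable = base a [^]\<^bsub>G\<^esub> k"
    proof -
      have "base b [^]\<^bsub>G\<^esub> l = base a [^]\<^bsub>G\<^esub> k"
        using a b k l base.hom_int_pow by metis
      then show ?thesis
        using stable_conj_pow[of l] a b by (simp add: base.hom_int_pow)
    qed
    ultimately have "k = l \<or> k = - l"
      using bal kl a stable_closed base_closed unfolding balanced_def by blast
    then have ab: "b [^] l = a [^] l \<or> b [^] l = a [^] (- l)"
      using k l by auto
    \<comment> \<open>The exponent \<open>l\<close> may be negative, while the condition asks for a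
      positive one; inverting both sides repairs this.\<close>
    have "b [^] (int m) = a [^] (int m) \<or> b [^] (int m) = a [^] (- int m)" if "m = nat \<bar>l\<bar>" for m
    proof (cases "l > 0")
      case True
      then show ?thesis using ab that by simp
    next
      case False
      then have "int m = - l" using that by simp
      then show ?thesis
        using ab a b A.int_pow_neg[of a l] A.int_pow_neg[of b l] A.int_pow_neg[of a "- l"] by fastforce
    qed
    then show ?thesis
      unfolding A.hnn_condition_def using kl(2) by (metis int_pow_int zero_less_abs_iff zero_less_nat_eq)
  qed
qed

end

section \<open>Finite quotients in which \<open>a\<close> and \<open>b\<close> have the same order\<close>

text \<open>If \<open>b^m\<close> is \<open>a^m\<close> or \<open>a^(-m)\<close>, every homomorphism
  to the integers agrees on \<open>a\<close> and \<open>b\<close> up to sign, so any \<phi>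
  separating \<open>g\<close> from the identity works. If the cyclic subgroups meet trivially,
  \<phi> is made to kill \<open>a \<otimes> inv b\<close> or \<open>a \<otimes> b\<close>; at least
  one of these generates a subgroup containing no nontrivial power of \<open>g\<close>.\<close>

lemma (in comm_group) compatible_separating_hom_int:
  assumes fg: "finitely_generated_group G" and a: "a \<in> carrier G" and b: "b \<in> carrier G"
    and cond: "hnn_condition a b" and ord: "ord a = ord b"
    and g: "g \<in> carrier G" "ord g = 0"
  shows "\<exists>\<phi>\<in>hom G integer_group. \<phi> g \<noteq> 0 \<and> (\<phi> b = \<phi> a \<or> \<phi> b = - \<phi> a)"
proof -
  have g0: "k = 0" if "g [^] (k::int) = \<one>" for k
    using that g ord_eq_0_int by blast
  consider m :: nat where "m > 0" "b [^] m = a [^] m \<or> b [^] m = a [^] (- int m)"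
    | "generate G {a} \<inter> generate G {b} = {\<one>}"
    using cond unfolding hnn_condition_def by blast
  then show ?thesis
  proof cases
    case 1
    obtain \<phi> where \<phi>: "\<phi> \<in> hom G integer_group" "\<phi> g \<noteq> 0"
      using separating_hom_int[OF fg triv_subgroup g(1)] g0 by blast
    have "int m * \<phi> b = int m * \<phi> a \<or> int m * \<phi> b = - int m * \<phi> a"
      using 1(2) hom_integer_pow[OF \<phi>(1) a] hom_integer_pow[OF \<phi>(1) b] by (metis int_pow_int)
    then have "int m * \<phi> b = int m * \<phi> a \<or> int m * \<phi> b = int m * (- \<phi> a)"
      by simp
    then have "\<phi> b = \<phi> a \<or> \<phi> b = - \<phi> a"
      using 1(1) unfolding mult_cancel_left by simp
    then show ?thesis
      using \<phi> by blast
  next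
    case 2
    have sub: "subgroup (generate G {x}) G" if "x \<in> carrier G" for x
      using generate_is_subgroup that by simp
    consider "\<And>k::int. g [^] k \<in> generate G {a \<otimes> inv b} \<Longrightarrow> k = 0" | "\<And>k::int. g [^] k \<in> generate G {a \<otimes> b} \<Longrightarrow> k = 0"
    proof -
      \<comment> \<open>With \<open>g^k = (a b^-1)^i\<close> and \<open>g^l = (a b)^j\<close>, the
        two expressions for \<open>g^(kl)\<close> give \<open>a^(il-jk) = b^(il+jk)\<close>, which
        lies in both cyclic subgroups and so is trivial. The common order of \<open>a\<close> and
        \<open>b\<close> then divides \<open>2il\<close>, whence \<open>g^(2kl)\<close> is
        trivial.\<close>
      have "k = 0 \<or> l = 0" if kl: "g [^] (k::int) \<in> generate G {a \<otimes> inv b}" "g [^] (l::int) \<in> generate G {a \<otimes> b}" for k l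
      proof -
        obtain i j :: int where ij: "g [^] k = (a \<otimes> inv b) [^] i" "g [^] l = (a \<otimes> b) [^] j"
          using kl generate_pow[of "a \<otimes> inv b"] generate_pow[of "a \<otimes> b"] a b by auto
        have e1: "g [^] (k * l) = a [^] (i * l) \<otimes> inv (b [^] (i * l))"
        proof -
          have "g [^] (k * l) = (a \<otimes> inv b) [^] (i * l)"
            using int_pow_pow[OF g(1), of k l] int_pow_pow[of "a \<otimes> inv b" i l] ij(1) a b by simp
          then show ?thesis
            using a b by (simp add: int_pow_distrib int_pow_inv)
        qed
        have e2: "g [^] (k * l) = a [^] (j * k) \<otimes> b [^] (j * k)"
        proof -
          have "g [^] (l * k) = (a \<otimes> b) [^] (j * k)"
            using int_pow_pow[OF g(1), of l k] int_pow_pow[of "a \<otimes> b" j k] ij(2) a b by simp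
          then show ?thesis
            using a b by (simp add: int_pow_distrib mult.commute)
        qed
        have cancel: "x \<otimes> y \<otimes> (z \<otimes> inv x) = z \<otimes> y" if "x \<in> carrier G" "y \<in> carrier G" "z \<in> carrier G" for x y z
        proof -
          have "x \<otimes> y \<otimes> (z \<otimes> inv x) = z \<otimes> y \<otimes> (x \<otimes> inv x)"
            using that inv_closed[OF that(1)] by (simp only: m_ac m_closed)
          then show ?thesis using that by simp
        qed
        have eq: "a [^] (i * l - j * k) = b [^] (i * l + j * k)"
        proof -
          have "a [^] (i * l - j * k) = a [^] (i * l) \<otimes> inv (b [^] (i * l)) \<otimes> (b [^] (i * l) \<otimes> inv (a [^] (j * k)))"
            using a b by (simp add: int_pow_diff m_assoc inv_cancel)
          also have "\<dots> = b [^] (i * l) \<otimes> b [^] (j * k)"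
            unfolding e1[symmetric] e2 using a b by (intro cancel) simp_all
          finally show ?thesis using b by (simp add: int_pow_mult)
        qed
        moreover have "a [^] n \<in> generate G {a}" "b [^] n \<in> generate G {b}" for n :: int
          using generate_pow[OF a] generate_pow[OF b] by blast+
        ultimately have "a [^] (i * l - j * k) \<in> generate G {a} \<inter> generate G {b}"
          by (metis IntI)
        then have t: "a [^] (i * l - j * k) = \<one>" "b [^] (i * l + j * k) = \<one>"
          using 2 eq by auto
        then have d: "int (ord a) dvd i * l - j * k" "int (ord a) dvd i * l + j * k"
          using int_pow_eq_id a b ord by metis+
        then have "int (ord a) dvd 2 * (i * l)"
          using dvd_add[OF d] by simp
        then have "a [^] (i * l * 2) = \<one>" "b [^] (i * l * 2) = \<one>"
          using int_pow_eq_id a b ord by (metis mult.commute)+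
        then have "g [^] (k * l * 2) = \<one>"
          unfolding int_pow_pow[OF g(1), symmetric, of "k * l"] e1
          using a b by (simp add: int_pow_distrib int_pow_pow int_pow_inv)
        then show ?thesis using g0[of "k * l * 2"] by simp
      qed
      then show thesis using that by blast
    qed
    then show ?thesis
    proof cases
      case 1
      then obtain \<phi> where \<phi>: "\<phi> \<in> hom G integer_group" "\<phi> g \<noteq> 0" "\<forall>c\<in>generate G {a \<otimes> inv b}. \<phi> c = 0"
        using separating_hom_int[OF fg sub[of "a \<otimes> inv b"] g(1)] a b by blast
      have "\<phi> (a \<otimes> inv b) = 0"
        using \<phi>(3) by (simp add: generate.incl)
      then have "\<phi> a + - \<phi> b = 0"
        using hom_mult[OF \<phi>(1) a, of "inv b"] hom_integer_pow[OF \<phi>(1) b, of "-1"] b by (simp add: int_pow_neg)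
      then show ?thesis
        using \<phi> by (intro bexI[of _ \<phi>]) auto
    next
      case 2
      then obtain \<phi> where \<phi>: "\<phi> \<in> hom G integer_group" "\<phi> g \<noteq> 0" "\<forall>c\<in>generate G {a \<otimes> b}. \<phi> c = 0"
        using separating_hom_int[OF fg sub[of "a \<otimes> b"] g(1)] a b by blast
      have "\<phi> (a \<otimes> b) = 0"
        using \<phi>(3) by (simp add: generate.incl)
      then have "\<phi> a + \<phi> b = 0"
        using hom_mult[OF \<phi>(1) a b] by simp
      then show ?thesis
        using \<phi> by (intro bexI[of _ \<phi>]) auto
    qed
  qed
qed

section \<open>Separating finitely many elements from subgroups in a finite quotient\<close>

lemma (in group) finite_index_Int:
  assumes "subgroup H G" "finite (rcosets H)" "subgroup K G" "finite (rcosets K)"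
  shows "subgroup (H \<inter> K) G \<and> finite (rcosets (H \<inter> K))"
proof
  show HK: "subgroup (H \<inter> K) G"
    using subgroups_Inter_pair assms by blast
  show "finite (rcosets (H \<inter> K))"
  proof (rule finite_rcosets_if_finite_image[OF HK, where f = "\<lambda>x. (H #> x, K #> x)"])
    show "finite ((\<lambda>x. (H #> x, K #> x)) ` carrier G)"
      by (rule finite_subset[of _ "((\<lambda>x. H #> x) ` carrier G) \<times> ((\<lambda>x. K #> x) ` carrier G)"])
        (use finite_rcosets_rcos_image assms in auto)
  qed (use rcos_eq_iff assms in auto)
qed

text \<open>The conclusion says that \<open>u\<close> stays outside \<open>C\<close> modulo
  \<open>B\<close>. Unlike containment of \<open>C\<close> in \<open>B\<close>, this survives
  shrinking \<open>B\<close>, so the subgroups found for the single pairs may be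
  intersected.\<close>

lemma (in comm_group) separate_finitely_many:
  assumes fg: "finitely_generated_group G" and fin: "finite P"
    and P: "\<And>C u. (C, u) \<in> P \<Longrightarrow> subgroup C G \<and> u \<in> carrier G \<and> u \<notin> C"
  shows "\<exists>B. subgroup B G \<and> finite (rcosets B) \<and> (\<forall>(C, u)\<in>P. \<forall>c\<in>C. inv c \<otimes> u \<notin> B)"
  using fin P
proof (induction P rule: finite_induct)
  case empty
  have "finite (rcosets (carrier G))"
    by (rule finite_rcosets_if_finite_image[OF subgroup_self, where f = "\<lambda>_. ()"]) auto
  then show ?case using subgroup_self by blast
next
  case (insert p P)
  obtain C u where p: "p = (C, u)" by fastforce
  then have C: "subgroup C G" "u \<in> carrier G" "u \<notin> C"
    using insert.prems[of C u] by auto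
  obtain B where B: "subgroup B G" "finite (rcosets B)" "\<forall>(C, u)\<in>P. \<forall>c\<in>C. inv c \<otimes> u \<notin> B"
    using insert.IH insert.prems by (meson insertI2)
  obtain D where D: "subgroup D G" "finite (rcosets D)" "C \<subseteq> D" "u \<notin> D"
    using separate_by_finite_index[OF fg C] by blast
  have "inv c \<otimes> u \<notin> D" if c: "c \<in> C" for c
  proof
    assume "inv c \<otimes> u \<in> D"
    moreover have "c \<in> D" using c D(3) by blast
    ultimately have "c \<otimes> (inv c \<otimes> u) \<in> D"
      using subgroup.m_closed[OF D(1)] by blast
    moreover have "c \<in> carrier G"
      using subgroup.mem_carrier[OF C(1) c] .
    ultimately show False
      using D(4) C(2) by (simp add: inv_cancel)
  qed
  then have "\<forall>(C, u)\<in>insert p P. \<forall>c\<in>C. inv c \<otimes> u \<notin> B \<inter> D"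
    using B(3) p by auto
  then show ?case
    using finite_index_Int[OF B(1,2) D(1,2)] by blast
qed

text \<open>For infinite order, the separating subgroup is cut down by a divisibility condition on
  \<phi>; as \<phi> takes the same value on \<open>a\<close> and \<open>b\<close> up to sign, the
  same exponents survive for both. For finite order, the nontrivial powers of \<open>a\<close> and
  \<open>b\<close> are added to the elements to be separated from the identity.\<close>

lemma (in comm_group) finite_index_same_order:
  assumes fg: "finitely_generated_group G" and a: "a \<in> carrier G" and b: "b \<in> carrier G"
    and cond: "hnn_condition a b" and ord: "ord a = ord b"
    and fin: "finite P" and P: "\<And>C u. (C, u) \<in> P \<Longrightarrow> subgroup C G \<and> u \<in> carrier G \<and> u \<notin> C"
  shows "\<exists>B. subgroup B G \<and> finite (rcosets B) \<and> (\<forall>(C, u)\<in>P. \<forall>c\<in>C. inv c \<otimes> u \<notin> B) \<and>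
    (\<forall>j::int. a [^] j \<in> B \<longleftrightarrow> b [^] j \<in> B)"
proof (cases "ord a = 0")
  case True
  obtain B where B: "subgroup B G" "finite (rcosets B)" "\<forall>(C, u)\<in>P. \<forall>c\<in>C. inv c \<otimes> u \<notin> B"
    using separate_finitely_many[OF fg fin P] by blast
  obtain \<phi> where \<phi>: "\<phi> \<in> hom G integer_group" "\<phi> a \<noteq> 0" "\<phi> b = \<phi> a \<or> \<phi> b = - \<phi> a"
    using compatible_separating_hom_int[OF fg a b cond ord a True] by blast
  obtain N :: nat where N: "N > 0" "\<And>s. s \<in> carrier G \<Longrightarrow> s [^] N \<in> B"
    using uniform_exponent[OF fg B(1)] ex_pow_in_finite_index[OF B(1,2)] by blast
  \<comment> \<open>With this modulus a power of \<open>a\<close> or \<open>b\<close> lies in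
    \<open>D\<close> exactly when \<open>N\<close> divides its exponent, and then it lies in
    \<open>B\<close> as well.\<close>
  define n where "n = \<bar>\<phi> a\<bar> * int N"
  have n: "n > 0" using N(1) \<phi>(2) by (simp add: n_def)
  define D where "D = {x \<in> carrier G. n dvd \<phi> x}"
  have \<phi>inv: "\<phi> (inv x) = - \<phi> x" if "x \<in> carrier G" for x
    using hom_integer_pow[OF \<phi>(1) that, of "-1"] that by (simp add: int_pow_neg)
  have \<phi>mult: "\<phi> (x \<otimes> y) = \<phi> x + \<phi> y" if "x \<in> carrier G" "y \<in> carrier G" for x y
    using hom_mult[OF \<phi>(1) that] by simp
  have D: "subgroup D G"
  proof (rule subgroupI)
    show "D \<noteq> {}"
      using hom_one[OF \<phi>(1) is_group group_integer_group] by (auto simp: D_def intro!: exI[of _ \<one>])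
  qed (auto simp: D_def \<phi>inv \<phi>mult)
  have finD: "finite (rcosets D)"
  proof (rule finite_rcosets_if_finite_image[OF D, where f = "\<lambda>x. \<phi> x mod n"])
    show "finite ((\<lambda>x. \<phi> x mod n) ` carrier G)"
      by (rule finite_subset[of _ "{0..<n}"]) (use n in auto)
    show "x \<otimes> inv y \<in> D" if "x \<in> carrier G" "y \<in> carrier G" "\<phi> x mod n = \<phi> y mod n" for x y
      using that by (auto simp: D_def \<phi>inv \<phi>mult mod_eq_dvd_iff)
  qed
  have pw: "x [^] j \<in> B \<inter> D \<longleftrightarrow> int N dvd j" if x: "x \<in> carrier G" "\<bar>\<phi> x\<bar> = \<bar>\<phi> a\<bar>" for x and j :: int
  proof -
    have "x [^] j \<in> D \<longleftrightarrow> \<bar>\<phi> a\<bar> * int N dvd \<bar>\<phi> x\<bar> * j"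
      using x(1) hom_integer_pow[OF \<phi>(1) x(1)]
      by (cases "\<phi> x \<ge> 0") (simp_all add: D_def n_def mult.commute)
    also have "\<dots> \<longleftrightarrow> int N dvd j"
      using x(2) \<phi>(2) by simp
    finally have "x [^] j \<in> D \<longleftrightarrow> int N dvd j" .
    moreover have "x [^] j \<in> B" if "int N dvd j"
    proof -
      obtain i where i: "j = int N * i" using \<open>int N dvd j\<close> by (elim dvdE)
      have "(x [^] N) [^] i \<in> B"
        using subgroup_int_pow_closed[OF B(1) N(2)[OF x(1)]] .
      then show ?thesis
        using i x(1) by (metis int_pow_int int_pow_pow)
    qed
    ultimately show ?thesis by blast
  qed
  have "a [^] j \<in> B \<inter> D \<longleftrightarrow> b [^] j \<in> B \<inter> D" for j :: int
  proof -
    have "\<bar>\<phi> b\<bar> = \<bar>\<phi> a\<bar>"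
      using \<phi>(3) by (elim disjE) simp_all
    then show ?thesis
      using pw[OF a] pw[OF b] by simp
  qed
  moreover have "\<forall>(C, u)\<in>P. \<forall>c\<in>C. inv c \<otimes> u \<notin> B \<inter> D"
    using B(3) by blast
  ultimately show ?thesis
    using finite_index_Int[OF B(1,2) D finD] by blast
next
  case False
  define n where "n = ord a"
  have n: "n > 0" using False by (simp add: n_def)
  define Q where "Q = (\<lambda>j. ({\<one>}, a [^] j)) ` {0<..<n} \<union> (\<lambda>j. ({\<one>}, b [^] j)) ` {0<..<n}"
  have ord_n: "ord x = n" if "x = a \<or> x = b" for x
    using that ord n_def by auto
  have npow: "x [^] j \<noteq> \<one>" if x: "x = a \<or> x = b" and j: "j \<in> {0<..<n}" for x and j :: nat
    using pow_eq_id[of x j] ord_n[OF x] x a b j by (auto dest: nat_dvd_not_less)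
  have "\<And>C u. (C, u) \<in> P \<union> Q \<Longrightarrow> subgroup C G \<and> u \<in> carrier G \<and> u \<notin> C"
  proof -
    fix C u assume "(C, u) \<in> P \<union> Q"
    then consider "(C, u) \<in> P" | x and j :: nat where "x = a \<or> x = b" "j \<in> {0<..<n}" "C = {\<one>}" "u = x [^] j"
      unfolding Q_def by blast
    then show "subgroup C G \<and> u \<in> carrier G \<and> u \<notin> C"
    proof cases
      case 1
      then show ?thesis using P by simp
    next
      case 2
      then show ?thesis using npow[OF 2(1,2)] a b triv_subgroup by auto
    qed
  qed
  moreover have "finite (P \<union> Q)"
    using fin by (simp add: Q_def)
  ultimately obtain B where B: "subgroup B G" "finite (rcosets B)" "\<forall>(C, u)\<in>P \<union> Q. \<forall>c\<in>C. inv c \<otimes> u \<notin> B"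
    using separate_finitely_many[OF fg] by meson
  have pw: "x [^] j \<in> B \<longleftrightarrow> int n dvd j" if x: "x = a \<or> x = b" for x and j :: int
  proof
    have xc: "x \<in> carrier G" using x a b by blast
    have xn: "x [^] int n = \<one>"
      using int_pow_eq_id[OF xc, of "int n"] ord_n[OF x] by simp
    show "x [^] j \<in> B" if "int n dvd j"
      using int_pow_eq_id[OF xc, of j] ord_n[OF x] that subgroup.one_closed[OF B(1)] by simp
    assume jB: "x [^] j \<in> B"
    define r where "r = nat (j mod int n)"
    have r: "int r = j mod int n" "r < n"
      using n by (auto simp: r_def nat_less_iff)
    have "x [^] j = x [^] (int n * (j div int n) + int r)"
      using r(1) by simp
    also have "\<dots> = x [^] r"
      using xc xn by (simp add: int_pow_mult int_pow_int del: mult_div_mod_eq flip: int_pow_pow)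
    finally have "inv \<one> \<otimes> x [^] r \<in> B"
      using jB xc by simp
    moreover have "({\<one>}, x [^] r) \<in> P \<union> Q" if "r > 0"
      using that r(2) x unfolding Q_def by auto
    ultimately have "r = 0"
      using bspec[OF B(3), of "({\<one>}, x [^] r)"] by (cases "r = 0") simp_all
    then show "int n dvd j"
      using r(1) by (simp add: dvd_eq_mod_eq_0)
  qed
  then have "a [^] j \<in> B \<longleftrightarrow> b [^] j \<in> B" for j :: int
    by simp
  then show ?thesis
    using B by blast
qed

text \<open>Rephrases the preceding lemma in the quotient by \<open>B\<close>. Equal orders of
  \<open>\<pi> a\<close> and \<open>\<pi> b\<close> make all orbits of the two left translations
  equally long, so that a stable letter can intertwine them.\<close>

lemma (in comm_group) finite_quotient_same_order:
  assumes fg: "finitely_generated_group G" and a: "a \<in> carrier G" and b: "b \<in> carrier G"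
    and cond: "hnn_condition a b" and ord: "ord a = ord b"
    and fin: "finite P" and P: "\<And>C u. (C, u) \<in> P \<Longrightarrow> subgroup C G \<and> u \<in> carrier G \<and> u \<notin> C"
  shows "\<exists>(Q :: 'a set monoid) \<pi>. group_hom G Q \<pi> \<and> finite (carrier Q) \<and>
    group.ord Q (\<pi> a) = group.ord Q (\<pi> b) \<and> (\<forall>(C, u)\<in>P. \<pi> u \<notin> \<pi> ` C)"
proof -
  obtain B where B: "subgroup B G" "finite (rcosets B)" "\<And>C u c. (C, u) \<in> P \<Longrightarrow> c \<in> C \<Longrightarrow> inv c \<otimes> u \<notin> B"
    and ab: "\<And>j::int. a [^] j \<in> B \<longleftrightarrow> b [^] j \<in> B"
    using finite_index_same_order[OF fg a b cond ord fin P] by blast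
  interpret B: normal B G
    using normal_iff_subgroup B(1) by blast
  interpret Q: group "G Mod B"
    by (rule B.factorgroup_is_group)
  let ?\<pi> = "\<lambda>x. B #> x"
  interpret \<pi>: group_hom G "G Mod B" ?\<pi>
    using B.r_coset_hom_Mod by unfold_locales
  have eq: "?\<pi> x = ?\<pi> y \<longleftrightarrow> x \<otimes> inv y \<in> B" if "x \<in> carrier G" "y \<in> carrier G" for x y
    using rcos_eq_iff[OF B(1) that] .
  have eq1: "?\<pi> x = \<one>\<^bsub>G Mod B\<^esub> \<longleftrightarrow> x \<in> B" if "x \<in> carrier G" for x
    using eq[OF that one_closed] \<pi>.hom_one that by simp
  have "finite (carrier (G Mod B))"
    using B(2) by (simp add: FactGroup_def)
  moreover have "Q.ord (?\<pi> a) = Q.ord (?\<pi> b)"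
  proof -
    have "?\<pi> a [^]\<^bsub>G Mod B\<^esub> j = \<one>\<^bsub>G Mod B\<^esub> \<longleftrightarrow> ?\<pi> b [^]\<^bsub>G Mod B\<^esub> j = \<one>\<^bsub>G Mod B\<^esub>" for j :: int
      using eq1[of "a [^] j"] eq1[of "b [^] j"] ab[of j] \<pi>.hom_int_pow[OF a, of j] \<pi>.hom_int_pow[OF b, of j] a b
      by simp
    then have "int (Q.ord (?\<pi> a)) dvd j \<longleftrightarrow> int (Q.ord (?\<pi> b)) dvd j" for j
      using Q.int_pow_eq_id[OF \<pi>.hom_closed[OF a]] Q.int_pow_eq_id[OF \<pi>.hom_closed[OF b]] by simp
    then show ?thesis
      by (metis dvd_antisym dvd_refl int_dvd_int_iff)
  qed
  moreover have "?\<pi> u \<notin> ?\<pi> ` C" if Cu: "(C, u) \<in> P" for C u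
  proof
    assume "?\<pi> u \<in> ?\<pi> ` C"
    then obtain c where c: "c \<in> C" "?\<pi> u = ?\<pi> c" by blast
    have cG: "c \<in> carrier G" "u \<in> carrier G"
      using P[OF Cu] subgroup.mem_carrier[OF _ c(1)] by blast+
    then have "u \<otimes> inv c \<in> B"
      using eq c(2) by simp
    then show False
      using B(3)[OF Cu c(1)] cG by (simp add: m_comm)
  qed
  ultimately show ?thesis
    using \<pi>.group_hom_axioms by (intro exI[of _ "G Mod B"] exI[of _ ?\<pi>]) blast
qed

section \<open>Actions of the HNN-extension on copies of a finite quotient\<close>

context hnn
begin

text \<open>The property passes to composites, so induction over \<open>G\<close> reduces it to the
  letters.\<close>

lemma action_shift:
  fixes act :: "'a option word set \<Rightarrow> 's \<times> int \<Rightarrow> 's \<times> int"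
  assumes one: "act \<one>\<^bsub>G\<^esub> = id"
    and mult: "\<And>g h. g \<in> carrier G \<Longrightarrow> h \<in> carrier G \<Longrightarrow> act (g \<otimes>\<^bsub>G\<^esub> h) = act g \<circ> act h"
    and gens: "\<And>g s z w. g \<in> base ` carrier A \<union> {stable, inv\<^bsub>G\<^esub> stable} \<Longrightarrow> s \<in> S \<Longrightarrow>
      fst (act g (s, z)) \<in> S \<and> act g (s, z + w) = (fst (act g (s, z)), snd (act g (s, z)) + w)"
    and g: "g \<in> carrier G" and s: "s \<in> S"
  shows "fst (act g (s, z)) \<in> S" "act g (s, z + w) = (fst (act g (s, z)), snd (act g (s, z)) + w)"
proof -
  define ok where "ok g \<longleftrightarrow> (\<forall>s\<in>S. \<forall>z w. fst (act g (s, z)) \<in> S \<and>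
    act g (s, z + w) = (fst (act g (s, z)), snd (act g (s, z)) + w))" for g
  have step: "ok (h \<otimes>\<^bsub>G\<^esub> g)"
    if h: "h \<in> base ` carrier A \<union> {stable, inv\<^bsub>G\<^esub> stable}" and g: "g \<in> carrier G" "ok g" for h g
    unfolding ok_def
  proof (intro ballI allI)
    fix s z w assume s: "s \<in> S"
    obtain s' z' where s': "act g (s, z) = (s', z')" by fastforce
    then have "s' \<in> S" "act g (s, z + w) = (s', z' + w)"
      using g(2) s unfolding ok_def by (metis fst_conv snd_conv)+
    moreover have "h \<in> carrier G" using h by auto
    ultimately show "fst (act (h \<otimes>\<^bsub>G\<^esub> g) (s, z)) \<in> S \<and>
      act (h \<otimes>\<^bsub>G\<^esub> g) (s, z + w) = (fst (act (h \<otimes>\<^bsub>G\<^esub> g) (s, z)), snd (act (h \<otimes>\<^bsub>G\<^esub> g) (s, z)) + w)"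
      using gens[OF h] g(1) s' by (simp add: mult)
  qed
  have "ok g"
    using g
  proof (induction rule: G_induct)
    case one
    then show ?case by (simp add: ok_def \<open>act \<one>\<^bsub>G\<^esub> = id\<close>)
  qed (intro step; simp)+
  then show "fst (act g (s, z)) \<in> S" "act g (s, z + w) = (fst (act g (s, z)), snd (act g (s, z)) + w)"
    using s unfolding ok_def by blast+
qed

text \<open>A triple \<open>(p, q, v)\<close> in \<open>E\<close> asks the stable letter to send
  \<open>p\<close> to \<open>q\<close> and to raise the integer coordinate by \<open>v\<close>.
  Distinct triples concern distinct orbits, so \<open>equivariant_bijection_extension\<close>
  supplies the rest; labels constant on orbits let \<open>T\<close> intertwine the actions of
  \<open>a\<close> and \<open>b\<close>.\<close>

lemma finite_quotient_action:
  fixes E :: "(('q \<times> nat) \<times> ('q \<times> nat) \<times> int) set"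
  assumes \<pi>: "group_hom A Q \<pi>" and finQ: "finite (carrier Q)"
    and ord: "group.ord Q (\<pi> a) = group.ord Q (\<pi> b)"
    and E: "\<And>p q v. (p, q, v) \<in> E \<Longrightarrow> p \<in> carrier Q \<times> {..<k} \<and> q \<in> carrier Q \<times> {..<k}"
    and disj: "\<And>p q v p' q' v' i j. (p, q, v) \<in> E \<Longrightarrow> (p', q', v') \<in> E \<Longrightarrow> (p, q, v) \<noteq> (p', q', v') \<Longrightarrow>
      (\<pi> a [^]\<^bsub>Q\<^esub> (i::nat) \<otimes>\<^bsub>Q\<^esub> fst p, snd p) \<noteq> (\<pi> a [^]\<^bsub>Q\<^esub> (j::nat) \<otimes>\<^bsub>Q\<^esub> fst p', snd p') \<and>
      (\<pi> b [^]\<^bsub>Q\<^esub> i \<otimes>\<^bsub>Q\<^esub> fst q, snd q) \<noteq> (\<pi> b [^]\<^bsub>Q\<^esub> j \<otimes>\<^bsub>Q\<^esub> fst q', snd q')"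
  obtains act where "act \<one>\<^bsub>G\<^esub> = id"
    and "\<And>g h. g \<in> carrier G \<Longrightarrow> h \<in> carrier G \<Longrightarrow> act (g \<otimes>\<^bsub>G\<^esub> h) = act g \<circ> act h"
    and "\<And>g s z w. g \<in> carrier G \<Longrightarrow> s \<in> carrier Q \<times> {..<k} \<Longrightarrow>
      fst (act g (s, z)) \<in> carrier Q \<times> {..<k} \<and> act g (s, z + w) = (fst (act g (s, z)), snd (act g (s, z)) + w)"
    and "\<And>x c i z. x \<in> carrier A \<Longrightarrow> c \<in> carrier Q \<Longrightarrow> i < k \<Longrightarrow>
      act (base x) ((c, i), z) = ((\<pi> x \<otimes>\<^bsub>Q\<^esub> c, i), z)"
    and "\<And>p q v z. (p, q, v) \<in> E \<Longrightarrow> act stable (p, z) = (q, z + v)"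
proof -
  interpret \<pi>: group_hom A Q \<pi> by (rule \<pi>)
  let ?S = "carrier Q \<times> {..<k}"
  define \<alpha> where "\<alpha> p = (\<pi> a \<otimes>\<^bsub>Q\<^esub> fst p, snd p)" for p :: "'q \<times> nat"
  define \<beta> where "\<beta> p = (\<pi> b \<otimes>\<^bsub>Q\<^esub> fst p, snd p)" for p :: "'q \<times> nat"
  have pa: "\<pi> a \<in> carrier Q" and pb: "\<pi> b \<in> carrier Q"
    using a b by auto
  have \<alpha>pow: "(\<alpha> ^^ i) p = (\<pi> a [^]\<^bsub>Q\<^esub> i \<otimes>\<^bsub>Q\<^esub> fst p, snd p)" if "fst p \<in> carrier Q" for i p
    using that
  proof (induction i)
    case (Suc i)
    then show ?case
      using pa \<pi>.H.nat_pow_Suc2[OF pa, of i] by (simp add: \<alpha>_def \<pi>.H.m_assoc[symmetric] del: \<pi>.H.nat_pow_Suc nat_pow_Suc)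
  qed simp
  have \<beta>pow: "(\<beta> ^^ i) p = (\<pi> b [^]\<^bsub>Q\<^esub> i \<otimes>\<^bsub>Q\<^esub> fst p, snd p)" if "fst p \<in> carrier Q" for i p
    using that
  proof (induction i)
    case (Suc i)
    then show ?case
      using pb \<pi>.H.nat_pow_Suc2[OF pb, of i] by (simp add: \<beta>_def \<pi>.H.m_assoc[symmetric] del: \<pi>.H.nat_pow_Suc nat_pow_Suc)
  qed simp
  have pow_eq: "\<pi> a [^]\<^bsub>Q\<^esub> i = \<pi> a [^]\<^bsub>Q\<^esub> j \<longleftrightarrow> \<pi> b [^]\<^bsub>Q\<^esub> i = \<pi> b [^]\<^bsub>Q\<^esub> j" for i j :: nat
    using \<pi>.H.int_pow_eq[OF pa, of "int i" "int j"] \<pi>.H.int_pow_eq[OF pb, of "int i" "int j"] ord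
    by (simp add: int_pow_int)
  have card: "card (carrier Q) > 0"
    using finQ \<pi>.H.one_closed card_gt_0_iff by blast
  have "\<exists>\<tau> w. bij_betw \<tau> ?S ?S \<and> (\<forall>p\<in>?S. \<tau> (\<alpha> p) = \<beta> (\<tau> p) \<and> w (\<alpha> p) = w p) \<and>
    (\<forall>(p, q, v)\<in>E. \<tau> p = q \<and> w p = v)"
  \<comment> \<open>By Lagrange's theorem the order of \<open>Q\<close> is a period of both
    translations.\<close>
  proof (rule equivariant_bijection_extension[where n = "card (carrier Q)"])
    show "finite ?S" using finQ by simp
    show "\<alpha> p \<in> ?S" "\<beta> p \<in> ?S" if "p \<in> ?S" for p
      using that pa pb by (auto simp: \<alpha>_def \<beta>_def)
    show "(\<alpha> ^^ card (carrier Q)) p = p" "(\<beta> ^^ card (carrier Q)) p = p" if "p \<in> ?S" for p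
      using that pa pb \<pi>.H.pow_order_eq_1[of "\<pi> a"] \<pi>.H.pow_order_eq_1[of "\<pi> b"]
      by (auto simp: \<alpha>pow \<beta>pow order_def)
    show "(\<alpha> ^^ i) p = (\<alpha> ^^ j) p \<longleftrightarrow> (\<beta> ^^ i) q = (\<beta> ^^ j) q" if "p \<in> ?S" "q \<in> ?S" for p q i j
      using that pa pb pow_eq[of i j] by (auto simp: \<alpha>pow \<beta>pow)
    show "p \<in> ?S \<and> q \<in> ?S" if "(p, q, v) \<in> E" for p q v
      using E[OF that] .
    show "(\<alpha> ^^ i) p \<noteq> (\<alpha> ^^ j) p' \<and> (\<beta> ^^ i) q \<noteq> (\<beta> ^^ j) q'"
      if "(p, q, v) \<in> E" "(p', q', v') \<in> E" "(p, q, v) \<noteq> (p', q', v')" for p q v p' q' v' i j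
    proof -
      have "fst p \<in> carrier Q" "fst q \<in> carrier Q" "fst p' \<in> carrier Q" "fst q' \<in> carrier Q"
        using E[OF that(1)] E[OF that(2)] by auto
      then show ?thesis
        using disj[OF that, of i j] by (simp add: \<alpha>pow \<beta>pow)
    qed
  qed (rule card)
  then obtain \<tau> w where \<tau>: "bij_betw \<tau> ?S ?S" and equi: "\<And>p. p \<in> ?S \<Longrightarrow> \<tau> (\<alpha> p) = \<beta> (\<tau> p) \<and> w (\<alpha> p) = w p"
    and \<tau>E: "\<And>p q v. (p, q, v) \<in> E \<Longrightarrow> \<tau> p = q \<and> w p = v"
    by blast
  define \<sigma> where "\<sigma> = inv_into ?S \<tau>"
  have \<tau>S: "\<tau> p \<in> ?S" and \<sigma>S: "\<sigma> p \<in> ?S" and \<sigma>\<tau>: "\<sigma> (\<tau> p) = p" and \<tau>\<sigma>: "\<tau> (\<sigma> p) = p" if "p \<in> ?S" for p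
    using \<open>p \<in> ?S\<close> \<tau> unfolding \<sigma>_def
    by (simp_all add: bij_betw_apply bij_betw_inv_into bij_betw_inv_into_left bij_betw_inv_into_right
        bij_betw_apply[OF bij_betw_inv_into])
  \<comment> \<open>Actions are maps on a whole type, so outside the finite set the letters act as
    the identity.\<close>
  define f where "f x = (\<lambda>(p, z :: int). if p \<in> ?S then ((\<pi> x \<otimes>\<^bsub>Q\<^esub> fst p, snd p), z) else (p, z))" for x
  define T where "T = (\<lambda>(p, z). if p \<in> ?S then (\<tau> p, z + w p) else (p, z))"
  define T' where "T' = (\<lambda>(p, z). if p \<in> ?S then (\<sigma> p, z - w (\<sigma> p)) else (p, z))"
  have "f (x \<otimes> y) = f x \<circ> f y" if "x \<in> carrier A" "y \<in> carrier A" for x y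
    using that by (auto simp: f_def fun_eq_iff \<pi>.H.m_assoc)
  moreover have "f \<one> = id"
    by (auto simp: f_def fun_eq_iff)
  moreover have "T \<circ> T' = id"
  proof
    show "(T \<circ> T') q = id q" for q
      using \<sigma>S \<tau>\<sigma> by (cases q) (simp add: T_def T'_def del: mem_Times_iff split: if_splits)
  qed
  moreover have "T' \<circ> T = id"
  proof
    show "(T' \<circ> T) q = id q" for q
      using \<tau>S \<sigma>\<tau> by (cases q) (simp add: T_def T'_def del: mem_Times_iff split: if_splits)
  qed
  moreover have "T \<circ> f a = f b \<circ> T"
  proof
    fix q :: "('q \<times> nat) \<times> int"
    obtain p z where q: "q = (p, z)" by fastforce
    show "(T \<circ> f a) q = (f b \<circ> T) q"
    proof (cases "p \<in> ?S")
      case True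
      then have "\<alpha> p \<in> ?S"
        using pa by (auto simp: \<alpha>_def)
      moreover have "f a (p, z) = (\<alpha> p, z)"
        using True by (simp add: f_def \<alpha>_def)
      moreover have "f b (\<tau> p, z + w p) = (\<beta> (\<tau> p), z + w p)"
        using \<tau>S[OF True] by (simp add: f_def \<beta>_def)
      ultimately show ?thesis
        using True equi[OF True] q by (simp add: T_def del: mem_Times_iff)
    next
      case False
      then show ?thesis using q by (simp add: T_def f_def del: mem_Times_iff)
    qed
  qed
  ultimately obtain act where one: "act \<one>\<^bsub>G\<^esub> = id"
    and mult: "\<forall>g\<in>carrier G. \<forall>h\<in>carrier G. act (g \<otimes>\<^bsub>G\<^esub> h) = act g \<circ> act h"
    and base: "\<And>x. x \<in> carrier A \<Longrightarrow> act (base x) = f x"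
    and stable: "act stable = T" "act (inv\<^bsub>G\<^esub> stable) = T'"
    using G_action[of f T T'] by blast
  have sh: "fst (act g (s, z)) \<in> ?S \<and> act g (s, z + w) = (fst (act g (s, z)), snd (act g (s, z)) + w)"
    if g: "g \<in> base ` carrier A \<union> {stable, inv\<^bsub>G\<^esub> stable}" and s: "s \<in> ?S" for g s z w
  proof -
    consider x where "x \<in> carrier A" "g = base x" | "g = stable" | "g = inv\<^bsub>G\<^esub> stable"
      using g by blast
    then show ?thesis
    proof cases
      case 1
      then show ?thesis using s base by (auto simp: f_def)
    next
      case 2
      then show ?thesis using s \<tau>S stable by (simp add: T_def del: mem_Times_iff)
    next
      case 3
      then show ?thesis using s \<sigma>S stable by (simp add: T'_def del: mem_Times_iff)
    qed
  qed
  have act_shift: "fst (act g (s, z)) \<in> ?S \<and> act g (s, z + w) = (fst (act g (s, z)), snd (act g (s, z)) + w)"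
    if g: "g \<in> carrier G" and s: "s \<in> ?S" for g s z w
  proof (intro conjI)
    show "fst (act g (s, z)) \<in> ?S"
      by (rule action_shift(1)[of act ?S, OF one]) (use mult sh g s in blast)+
    show "act g (s, z + w) = (fst (act g (s, z)), snd (act g (s, z)) + w)"
      by (rule action_shift(2)[of act ?S, OF one]) (use mult sh g s in blast)+
  qed
  have act_base: "act (base x) ((c, i), z) = ((\<pi> x \<otimes>\<^bsub>Q\<^esub> c, i), z)"
    if "x \<in> carrier A" "c \<in> carrier Q" "i < k" for x c i z
    using base that by (simp add: f_def)
  have act_stable: "act stable (p, z) = (q, z + v)" if "(p, q, v) \<in> E" for p q v z
    using \<tau>E[OF that] E[OF that] stable by (simp add: T_def del: mem_Times_iff)
  have act_mult: "act (g \<otimes>\<^bsub>G\<^esub> h) = act g \<circ> act h" if "g \<in> carrier G" "h \<in> carrier G" for g h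
    using mult that by blast
  show thesis
    using that[OF one act_mult act_shift act_base act_stable] .
qed

end

section \<open>Virtual retracts in the HNN-extension\<close>

locale compatible_hnn = hnn +
  assumes fg: "finitely_generated_group A" and cond: "A.hnn_condition a b" and ord: "A.ord a = A.ord b"
begin

text \<open>If \<open>\<phi> b = - \<phi> a\<close>, the map \<open>\<phi>\<close> extends to a homomorphism from \<open>G\<close> to the infinite dihedral group,
  here acting on the two sheets of \<open>bool \<times> \<int>\<close>.\<close>

lemma virtual_retract_base_infinite:
  assumes x: "x \<in> carrier A" and inf: "A.ord x = 0"
  shows "virtual_retract (generate G {base x}) G"
proof -
  obtain \<phi> where \<phi>: "\<phi> \<in> hom A integer_group" "\<phi> x \<noteq> 0" "\<phi> b = \<phi> a \<or> \<phi> b = - \<phi> a"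
    using A.compatible_separating_hom_int[OF fg a b cond ord x inf] by blast
  define f where "f y = (\<lambda>(s, z :: int). (s, if s then z + \<phi> y else z - \<phi> y))" for y
  define T where "T = (\<lambda>(s, z :: int). (if \<phi> b = \<phi> a then s else \<not> s, z))"
  have "f (y \<otimes> z) = f y \<circ> f z" if "y \<in> carrier A" "z \<in> carrier A" for y z
    using hom_mult[OF \<phi>(1) that] by (auto simp: f_def fun_eq_iff)
  moreover have "f \<one> = id"
    using hom_one[OF \<phi>(1) A.is_group group_integer_group] by (auto simp: f_def fun_eq_iff)
  moreover have "T \<circ> T = id"
    by (auto simp: T_def fun_eq_iff)
  moreover have "T \<circ> f a = f b \<circ> T"
    using \<phi>(3) by (auto simp: T_def f_def fun_eq_iff)
  ultimately obtain act where one: "act \<one>\<^bsub>G\<^esub> = id"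
    and mult: "\<forall>g\<in>carrier G. \<forall>h\<in>carrier G. act (g \<otimes>\<^bsub>G\<^esub> h) = act g \<circ> act h"
    and base: "\<And>x. x \<in> carrier A \<Longrightarrow> act (base x) = f x"
    and stable: "act stable = T" "act (inv\<^bsub>G\<^esub> stable) = T"
    using G_action[of f T T] by blast
  have gens: "fst (act g (s, z)) \<in> UNIV \<and> act g (s, z + w) = (fst (act g (s, z)), snd (act g (s, z)) + w)"
    if g: "g \<in> base ` carrier A \<union> {stable, inv\<^bsub>G\<^esub> stable}" for g s z w
  proof -
    consider x where "x \<in> carrier A" "g = base x" | "act g = T"
      using g stable by blast
    then show ?thesis
      by cases (simp_all add: base f_def T_def)
  qed
  show ?thesis
  proof (rule G.virtual_retract_if_action_shift[where act = act and S = UNIV and s = True and d = "\<phi> x"])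
    show "act g (s, z + w) = (fst (act g (s, z)), snd (act g (s, z)) + w)" if "g \<in> carrier G" for g s z w
      by (rule action_shift(2)[of act UNIV, OF one]) (use mult gens that in blast)+
    show "act (base x) (True, 0) = (True, \<phi> x)"
      using x by (simp add: base f_def)
  qed (use one mult x \<phi>(2) in auto)
qed

text \<open>Choose the finite quotient so that the nontrivial powers of \<open>x\<close> survive in
  it. One copy and no prescription for the stable letter suffice: the cyclic group then acts
  faithfully by translations.\<close>

lemma virtual_retract_base_finite:
  assumes x: "x \<in> carrier A" and tors: "A.ord x \<noteq> 0"
  shows "virtual_retract (generate G {base x}) G"
proof -
  define P where "P = (\<lambda>j. ({\<one>}, x [^] j)) ` {0<..<A.ord x}"
  have "subgroup C A \<and> u \<in> carrier A \<and> u \<notin> C" if Cu: "(C, u) \<in> P" for C u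
  proof -
    obtain j where j: "0 < j" "j < A.ord x" "C = {\<one>}" "u = x [^] j"
      using Cu by (auto simp: P_def)
    then have "x [^] j \<noteq> \<one>"
      using A.pow_eq_id[OF x, of j] by (auto dest: nat_dvd_not_less)
    then show ?thesis
      using j x A.triv_subgroup by simp
  qed
  then obtain Q :: "'a set monoid" and \<pi> where \<pi>: "group_hom A Q \<pi>" and finQ: "finite (carrier Q)"
    and ordQ: "group.ord Q (\<pi> a) = group.ord Q (\<pi> b)" and P: "\<forall>(C, u)\<in>P. \<pi> u \<notin> \<pi> ` C"
    using A.finite_quotient_same_order[OF fg a b cond ord, of P] by (auto simp: P_def)
  interpret \<pi>: group_hom A Q \<pi> by (rule \<pi>)
  obtain act :: "'a option word set \<Rightarrow> ('a set \<times> nat) \<times> int \<Rightarrow> ('a set \<times> nat) \<times> int"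
    where one: "act \<one>\<^bsub>G\<^esub> = id"
    and mult: "\<And>g h. g \<in> carrier G \<Longrightarrow> h \<in> carrier G \<Longrightarrow> act (g \<otimes>\<^bsub>G\<^esub> h) = act g \<circ> act h"
    and sh: "\<And>g s z w. g \<in> carrier G \<Longrightarrow> s \<in> carrier Q \<times> {..<1} \<Longrightarrow> fst (act g (s, z)) \<in> carrier Q \<times> {..<1} \<and>
      act g (s, z + w) = (fst (act g (s, z)), snd (act g (s, z)) + w)"
    and base: "\<And>x c i z. x \<in> carrier A \<Longrightarrow> c \<in> carrier Q \<Longrightarrow> i < 1 \<Longrightarrow>
      act (base x) ((c, i), z) = ((\<pi> x \<otimes>\<^bsub>Q\<^esub> c, i), z)"
    by (rule finite_quotient_action[OF \<pi> finQ ordQ, where E = "{}" and k = 1])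
      (blast, blast, rule that)
  \<comment> \<open>The integer coordinate has no influence on the first one, so forgetting it
    leaves an action on a finite set.\<close>
  have drop: "fst (act g (s, z)) = fst (act g (s, 0))" if "g \<in> carrier G" "s \<in> carrier Q \<times> {..<1}" for g s z
    using sh[OF that, of 0 z] by simp
  show ?thesis
  proof (rule G.virtual_retract_if_finite_action[where act = "\<lambda>g s. fst (act g (s, 0))" and S = "carrier Q \<times> {..<1}"])
    show "fst (act (g \<otimes>\<^bsub>G\<^esub> h) (s, 0)) = fst (act g (fst (act h (s, 0)), 0))"
      if "g \<in> carrier G" "h \<in> carrier G" "s \<in> carrier Q \<times> {..<1}" for g h s
      using that drop[of g "fst (act h (s, 0))" "snd (act h (s, 0))"] conjunct1[OF sh[of h s 0]] by (simp add: mult)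
    show "subgroup (generate G {base x}) G"
      using G.generate_is_subgroup x by simp
    show "h = \<one>\<^bsub>G\<^esub>"
      if h: "h \<in> generate G {base x}" and fixes_all: "\<And>s. s \<in> carrier Q \<times> {..<1} \<Longrightarrow> fst (act h (s, 0)) = s" for h
    proof -
      obtain j :: int where j: "h = base x [^]\<^bsub>G\<^esub> j"
        using h G.generate_pow[of "base x"] x by auto
      define r where "r = nat (j mod int (A.ord x))"
      have r: "int r = j mod int (A.ord x)" "r < A.ord x"
        using tors by (auto simp: r_def nat_less_iff)
      have "x [^] j = x [^] int r"
        using A.int_pow_eq[OF x] r(1) by (metis dvd_minus_mod minus_diff_eq dvd_minus_iff)
      then have h_eq: "h = base (x [^] r)"
        using j x by (simp add: base.hom_int_pow[symmetric] int_pow_int)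
      have "\<pi> (x [^] r) = \<one>\<^bsub>Q\<^esub>"
        using fixes_all[of "(\<one>\<^bsub>Q\<^esub>, 0)"] base[of "x [^] r" "\<one>\<^bsub>Q\<^esub>" 0 0] h_eq x by simp
      then have "({\<one>}, x [^] r) \<notin> P"
        using bspec[OF P, of "({\<one>}, x [^] r)"] by auto
      then have "r = 0"
        using r(2) by (auto simp: P_def)
      then show ?thesis using h_eq by simp
    qed
  qed (use one sh finQ in auto)
qed

lemma virtual_retract_base: "x \<in> carrier A \<Longrightarrow> virtual_retract (generate G {base x}) G"
  using virtual_retract_base_infinite virtual_retract_base_finite by blast

section \<open>Words in the stable letter and cyclic reduction\<close>

definition stable_pow :: "bool \<Rightarrow> 'a option word set" where
  "stable_pow e = (if e then stable else inv\<^bsub>G\<^esub> stable)"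

text \<open>\<open>[(u\<^sub>0, e\<^sub>0), \<dots>, (u\<^sub>k, e\<^sub>k)]\<close> stands for \<open>t\<^bsup>e\<^sub>k\<^esup> u\<^sub>k \<cdots> t\<^bsup>e\<^sub>0\<^esup> u\<^sub>0\<close>: under a left action the head of the list acts first.\<close>

primrec eval_list :: "('a \<times> bool) list \<Rightarrow> 'a option word set" where
  "eval_list [] = \<one>\<^bsub>G\<^esub>"
| "eval_list (l # L) = eval_list L \<otimes>\<^bsub>G\<^esub> (stable_pow (snd l) \<otimes>\<^bsub>G\<^esub> base (fst l))"

text \<open>The elements that the defining relation carries back into \<open>A\<close> under
  conjugation by \<open>stable_pow e\<close>; hence the dependence on \<open>e\<close>.\<close>

definition assoc_subgroup :: "bool \<Rightarrow> 'a set" where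
  "assoc_subgroup e = generate A {if e then a else b}"

lemma stable_pow_closed [simp]: "stable_pow e \<in> carrier G"
  by (simp add: stable_pow_def)

lemma eval_list_closed [simp]: "fst ` set L \<subseteq> carrier A \<Longrightarrow> eval_list L \<in> carrier G"
  by (induction L) auto

lemma eval_list_append:
  "fst ` set L \<subseteq> carrier A \<Longrightarrow> fst ` set M \<subseteq> carrier A \<Longrightarrow> eval_list (L @ M) = eval_list M \<otimes>\<^bsub>G\<^esub> eval_list L"
  by (induction L) (simp_all add: G.m_assoc)

text \<open>Britton's pinch: the defining relation, read in one direction or the other, removes two
  opposite stable letters.\<close>

lemma stable_pow_pinch:
  assumes "u \<in> assoc_subgroup e"
  shows "\<exists>y\<in>carrier A. stable_pow e \<otimes>\<^bsub>G\<^esub> base u \<otimes>\<^bsub>G\<^esub> stable_pow (\<not> e) = base y"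
proof (cases e)
  case True
  then obtain j :: int where "u = a [^] j"
    using assms A.generate_pow[OF a] by (auto simp: assoc_subgroup_def)
  then show ?thesis
    using True stable_conj_pow[of j] b by (intro bexI[of _ "b [^] j"]) (auto simp: stable_pow_def)
next
  case False
  then obtain j :: int where j: "u = b [^] j"
    using assms A.generate_pow[OF b] by (auto simp: assoc_subgroup_def)
  have "inv\<^bsub>G\<^esub> stable \<otimes>\<^bsub>G\<^esub> base (b [^] j) \<otimes>\<^bsub>G\<^esub> stable = base (a [^] j)"
    unfolding stable_conj_pow[symmetric] using a by (simp add: G.m_assoc G.inv_cancel del: base.hom_int_pow)
  then show ?thesis
    using False j a by (intro bexI[of _ "a [^] j"]) (auto simp: stable_pow_def)
qed

text \<open>On \<open>k = length L\<close> copies of a finite quotient \<open>Q\<close> of \<open>A\<close>, let \<open>A\<close> act by translation and require that the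
  \<open>i\<close>-th syllable moves \<open>1\<close> in the \<open>i\<close>-th copy to \<open>1\<close> in the next copy (cyclically), raising the \<open>\<int>\<close>-coordinate
  by one. Reducedness survives in \<open>Q\<close> and says that these requirements concern different orbits, so
  that they extend to an action of \<open>t\<close>.\<close>

lemma virtual_retract_reduced:
  assumes L: "L \<noteq> []" "fst ` set L \<subseteq> carrier A"
    and red: "\<And>i i'. i < length L \<Longrightarrow> i' = Suc i mod length L \<Longrightarrow> snd (L ! i) \<noteq> snd (L ! i') \<Longrightarrow>
      fst (L ! i') \<notin> assoc_subgroup (snd (L ! i'))"
  shows "virtual_retract (generate G {eval_list L}) G"
proof -
  define k where "k = length L"
  have k: "k > 0" using L(1) by (simp add: k_def)
  define nx where "nx i = Suc i mod k" for i
  have nx: "nx i < k" for i using k by (simp add: nx_def)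
  have nx_inj: "i = l" if "nx i = nx l" "i < k" "l < k" for i l
    using that by (auto simp: nx_def mod_Suc split: if_splits)
  have LA: "fst (L ! i) \<in> carrier A" if "i < k" for i
    using L(2) that by (auto simp: k_def)
  \<comment> \<open>Coefficients outside an associated subgroup are required to stay outside its
    image in the quotient.\<close>
  define P where "P = {(assoc_subgroup e, u) | e u. u \<in> fst ` set L \<and> u \<notin> assoc_subgroup e}"
  have "P \<subseteq> (\<lambda>(e, u). (assoc_subgroup e, u)) ` (UNIV \<times> fst ` set L)"
    by (auto simp: P_def)
  then have finP: "finite P"
    by (rule finite_subset) simp
  have "subgroup C A \<and> u \<in> carrier A \<and> u \<notin> C" if "(C, u) \<in> P" for C u
    using that L(2) A.generate_is_subgroup a b by (auto simp: P_def assoc_subgroup_def)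
  then obtain Q :: "'a set monoid" and \<pi> where \<pi>: "group_hom A Q \<pi>" and finQ: "finite (carrier Q)"
    and ordQ: "group.ord Q (\<pi> a) = group.ord Q (\<pi> b)" and P: "\<forall>(C, u)\<in>P. \<pi> u \<notin> \<pi> ` C"
    using A.finite_quotient_same_order[OF fg a b cond ord finP] by blast
  interpret \<pi>: group_hom A Q \<pi> by (rule \<pi>)
  define h where "h e = (if e then a else b)" for e :: bool
  have hA: "h e \<in> carrier A" for e using a b by (simp add: h_def)
  \<comment> \<open>That is, \<open>\<pi> (fst (L ! i))\<close> and the identity lie in different
    orbits of translation by \<open>\<pi> (h e)\<close>.\<close>
  have sep: "\<pi> (h e) [^]\<^bsub>Q\<^esub> m \<otimes>\<^bsub>Q\<^esub> \<pi> (fst (L ! i)) \<noteq> \<pi> (h e) [^]\<^bsub>Q\<^esub> j"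
    if "i < k" "fst (L ! i) \<notin> assoc_subgroup e" for e i and m j :: nat
  proof
    assume eq: "\<pi> (h e) [^]\<^bsub>Q\<^esub> m \<otimes>\<^bsub>Q\<^esub> \<pi> (fst (L ! i)) = \<pi> (h e) [^]\<^bsub>Q\<^esub> j"
    have ph: "\<pi> (h e) \<in> carrier Q" using hA by simp
    have "\<pi> (fst (L ! i)) = inv\<^bsub>Q\<^esub> (\<pi> (h e) [^]\<^bsub>Q\<^esub> m) \<otimes>\<^bsub>Q\<^esub> (\<pi> (h e) [^]\<^bsub>Q\<^esub> j)"
      unfolding eq[symmetric] using ph LA[OF that(1)] by (simp add: \<pi>.H.inv_cancel)
    also have "\<dots> = \<pi> (h e) [^]\<^bsub>Q\<^esub> (- int m) \<otimes>\<^bsub>Q\<^esub> \<pi> (h e) [^]\<^bsub>Q\<^esub> int j"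
      using ph by (simp add: \<pi>.H.int_pow_neg int_pow_int)
    also have "\<dots> = \<pi> (h e [^] (- int m + int j))"
      using \<pi>.H.int_pow_mult[OF ph] \<pi>.hom_int_pow[OF hA] by metis
    finally have "\<pi> (fst (L ! i)) \<in> \<pi> ` assoc_subgroup e"
      using A.generate_pow[OF hA[of e]] by (auto simp: assoc_subgroup_def h_def)
    moreover have "(assoc_subgroup e, fst (L ! i)) \<in> P"
      using that by (auto simp: P_def k_def)
    ultimately show False using P by blast
  qed
  \<comment> \<open>In the \<open>i\<close>-th syllable the stable letter itself leads from
    \<open>side True i\<close> to \<open>side False i\<close>. For exponent -1 the syllable runs
    against it, so the two endpoints are exchanged.\<close>
  define side where "side e i = (if snd (L ! i) = e then (\<pi> (fst (L ! i)), i) else (\<one>\<^bsub>Q\<^esub>, nx i))" for e i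
  define rot where "rot e m p = (\<pi> (h e) [^]\<^bsub>Q\<^esub> (m::nat) \<otimes>\<^bsub>Q\<^esub> fst p, snd p)" for e m and p :: "'a set \<times> nat"
  \<comment> \<open>Such points share a copy only if \<open>i = nx l\<close>; then consecutive
    syllables have opposite exponents, and reducedness applies to the coefficient at
    \<open>i\<close>.\<close>
  have mixed: "rot e m (side e i) \<noteq> rot e j (side e l)"
    if "i < k" "l < k" "snd (L ! i) = e" "snd (L ! l) \<noteq> e" for e i l m j
  proof
    assume "rot e m (side e i) = rot e j (side e l)"
    moreover have "rot e m (side e i) = (\<pi> (h e) [^]\<^bsub>Q\<^esub> m \<otimes>\<^bsub>Q\<^esub> \<pi> (fst (L ! i)), i)"
      "rot e j (side e l) = (\<pi> (h e) [^]\<^bsub>Q\<^esub> j, nx l)"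
      using that hA[of e] by (simp_all add: rot_def side_def)
    ultimately have i: "i = nx l" and eq: "\<pi> (h e) [^]\<^bsub>Q\<^esub> m \<otimes>\<^bsub>Q\<^esub> \<pi> (fst (L ! i)) = \<pi> (h e) [^]\<^bsub>Q\<^esub> j"
      by (metis prod.inject)+
    have "fst (L ! i) \<notin> assoc_subgroup (snd (L ! i))"
      using red[of l i] that i(1) by (simp add: nx_def k_def)
    then show False
      using sep[OF that(1), of e m j] eq that(3) by simp
  qed
  have disj: "rot e m (side e i) \<noteq> rot e j (side e l)" if "i < k" "l < k" "i \<noteq> l" for e i l m j
  proof (cases "snd (L ! i) = e")
    case True
    show ?thesis
    proof (cases "snd (L ! l) = e")
      case l: True
      show ?thesis using True l that by (simp add: rot_def side_def)
    qed (use mixed that True in blast)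
  next
    case i: False
    show ?thesis
    proof (cases "snd (L ! l) = e")
      case False
      show ?thesis using i False that nx_inj by (auto simp: rot_def side_def)
    next
      case l: True
      show ?thesis using mixed[OF that(2,1) l i, of j m] by metis
    qed
  qed
  \<comment> \<open>The label -1 for exponent -1 makes the inverse of the stable letter raise the
    coordinate by one too.\<close>
  define E where "E = (\<lambda>i. (side True i, side False i, if snd (L ! i) then 1 else - 1 :: int)) ` {..<k}"
  have sideS: "side e i \<in> carrier Q \<times> {..<k}" if "i < k" for e i
    using that nx LA by (simp add: side_def)
  have ES: "p \<in> carrier Q \<times> {..<k} \<and> q \<in> carrier Q \<times> {..<k}" if "(p, q, v) \<in> E" for p q v
    using that sideS by (auto simp: E_def)
  have Edisj: "(\<pi> a [^]\<^bsub>Q\<^esub> m \<otimes>\<^bsub>Q\<^esub> fst p, snd p) \<noteq> (\<pi> a [^]\<^bsub>Q\<^esub> j \<otimes>\<^bsub>Q\<^esub> fst p', snd p') \<and>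
      (\<pi> b [^]\<^bsub>Q\<^esub> m \<otimes>\<^bsub>Q\<^esub> fst q, snd q) \<noteq> (\<pi> b [^]\<^bsub>Q\<^esub> j \<otimes>\<^bsub>Q\<^esub> fst q', snd q')"
    if e: "(p, q, v) \<in> E" "(p', q', v') \<in> E" "(p, q, v) \<noteq> (p', q', v')" for p q v p' q' v' and m j :: nat
  proof -
    obtain i where i: "i < k" "p = side True i" "q = side False i" "v = (if snd (L ! i) then 1 else - 1)"
      using e(1) by (auto simp: E_def)
    obtain l where l: "l < k" "p' = side True l" "q' = side False l" "v' = (if snd (L ! l) then 1 else - 1)"
      using e(2) by (auto simp: E_def)
    have "i \<noteq> l"
      using e(3) i l by blast
    then show ?thesis
      using disj[of i l True m j] disj[of i l False m j] i l by (simp add: rot_def h_def)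
  qed
  obtain act :: "'a option word set \<Rightarrow> ('a set \<times> nat) \<times> int \<Rightarrow> ('a set \<times> nat) \<times> int"
    where one: "act \<one>\<^bsub>G\<^esub> = id"
    and mult: "\<And>g h. g \<in> carrier G \<Longrightarrow> h \<in> carrier G \<Longrightarrow> act (g \<otimes>\<^bsub>G\<^esub> h) = act g \<circ> act h"
    and sh: "\<And>g s z w. g \<in> carrier G \<Longrightarrow> s \<in> carrier Q \<times> {..<k} \<Longrightarrow> fst (act g (s, z)) \<in> carrier Q \<times> {..<k} \<and>
      act g (s, z + w) = (fst (act g (s, z)), snd (act g (s, z)) + w)"
    and base: "\<And>x c i z. x \<in> carrier A \<Longrightarrow> c \<in> carrier Q \<Longrightarrow> i < k \<Longrightarrow>
      act (base x) ((c, i), z) = ((\<pi> x \<otimes>\<^bsub>Q\<^esub> c, i), z)"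
    and E: "\<And>p q v z. (p, q, v) \<in> E \<Longrightarrow> act stable (p, z) = (q, z + v)"
    by (rule finite_quotient_action[OF \<pi> finQ ordQ, where E = E and k = k])
      (erule ES, erule (2) Edisj, rule that)
  have step: "act (stable_pow (snd (L ! i)) \<otimes>\<^bsub>G\<^esub> base (fst (L ! i))) ((\<one>\<^bsub>Q\<^esub>, i), z) = ((\<one>\<^bsub>Q\<^esub>, nx i), z + 1)"
    if i: "i < k" for i z
  proof -
    have b1: "act (base (fst (L ! i))) ((\<one>\<^bsub>Q\<^esub>, i), z) = ((\<pi> (fst (L ! i)), i), z)"
      using base[OF LA[OF i] \<pi>.H.one_closed i] LA[OF i] by simp
    have e: "(side True i, side False i, if snd (L ! i) then 1 else - 1) \<in> E"
      using i by (auto simp: E_def)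
    show ?thesis
    proof (cases "snd (L ! i)")
      case True
      then show ?thesis
        using E[OF e, of z] b1 LA[OF i] by (simp add: mult stable_pow_def side_def)
    next
      case False
      then have "act stable ((\<one>\<^bsub>Q\<^esub>, nx i), z + 1) = ((\<pi> (fst (L ! i)), i), z)"
        using E[OF e, of "z + 1"] by (simp add: side_def)
      then have "act (inv\<^bsub>G\<^esub> stable) ((\<pi> (fst (L ! i)), i), z) = ((\<one>\<^bsub>Q\<^esub>, nx i), z + 1)"
        using G.action_inv(1)[of act stable "((\<one>\<^bsub>Q\<^esub>, nx i), z + 1)"] one mult by simp
      then show ?thesis
        using False b1 LA[OF i] by (simp add: mult stable_pow_def)
    qed
  qed
  \<comment> \<open>Only at \<open>m = k\<close> does the copy index wrap around: the full word
    returns to its starting fibre, translated by \<open>k\<close>.\<close>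
  have path: "act (eval_list (take m L)) ((\<one>\<^bsub>Q\<^esub>, 0), 0) = ((\<one>\<^bsub>Q\<^esub>, m mod k), int m)" if "m \<le> k" for m
    using that
  proof (induction m)
    case 0
    then show ?case by (simp add: one)
  next
    case (Suc m)
    then have m: "m < k" by simp
    have sub: "fst ` set (take m L) \<subseteq> carrier A"
      using L(2) set_take_subset by fastforce
    have "take (Suc m) L = take m L @ [L ! m]"
      using m by (simp add: k_def take_Suc_conv_app_nth)
    then have "eval_list (take (Suc m) L)
        = (stable_pow (snd (L ! m)) \<otimes>\<^bsub>G\<^esub> base (fst (L ! m))) \<otimes>\<^bsub>G\<^esub> eval_list (take m L)"
      using eval_list_append[OF sub, of "[L ! m]"] LA[OF m] by simp
    then have "act (eval_list (take (Suc m) L)) ((\<one>\<^bsub>Q\<^esub>, 0), 0)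
        = act (stable_pow (snd (L ! m)) \<otimes>\<^bsub>G\<^esub> base (fst (L ! m))) ((\<one>\<^bsub>Q\<^esub>, m), int m)"
      using Suc m LA[OF m] sub by (simp add: mult)
    also have "\<dots> = ((\<one>\<^bsub>Q\<^esub>, Suc m mod k), int (Suc m))"
      using step[OF m, of "int m"] by (simp add: nx_def)
    finally show ?case .
  qed
  show ?thesis
  proof (rule G.virtual_retract_if_action_shift[where act = act and S = "carrier Q \<times> {..<k}"
        and s = "(\<one>\<^bsub>Q\<^esub>, 0)" and d = "int k"])
    show "act (eval_list L) ((\<one>\<^bsub>Q\<^esub>, 0), 0) = ((\<one>\<^bsub>Q\<^esub>, 0), int k)"
      using path[of k] by (simp add: k_def)
    show "eval_list L \<in> carrier G"
      using L(2) by simp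
    show "fst (act g (s, z)) \<in> carrier Q \<times> {..<k}"
      "act g (s, z + w) = (fst (act g (s, z)), snd (act g (s, z)) + w)"
      if "g \<in> carrier G" "s \<in> carrier Q \<times> {..<k}" for g s z w
      using sh[OF that] by blast+
  qed (use one mult finQ k in auto)
qed

text \<open>Rotating by one syllable conjugates the value by that syllable.\<close>

lemma virtual_retract_rotate:
  assumes "fst ` set L \<subseteq> carrier A" "virtual_retract (generate G {eval_list (rotate n L)}) G"
  shows "virtual_retract (generate G {eval_list L}) G"
  using assms
proof (induction n arbitrary: L)
  case (Suc n)
  have r: "virtual_retract (generate G {eval_list (rotate1 L)}) G"
    using Suc.IH[of "rotate1 L"] Suc.prems by (simp add: rotate1_rotate_swap)
  show ?case
  proof (cases L)
    case (Cons l M)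
    let ?y = "stable_pow (snd l) \<otimes>\<^bsub>G\<^esub> base (fst l)"
    have y: "?y \<in> carrier G" and M: "eval_list M \<in> carrier G" "fst ` set M \<subseteq> carrier A"
      using Suc.prems(1) Cons by simp_all
    have "eval_list (rotate1 L) = ?y \<otimes>\<^bsub>G\<^esub> eval_list M"
      using Cons eval_list_append[OF M(2), of "[l]"] y Suc.prems(1) by simp
    moreover have "inv\<^bsub>G\<^esub> ?y \<otimes>\<^bsub>G\<^esub> (?y \<otimes>\<^bsub>G\<^esub> eval_list M) \<otimes>\<^bsub>G\<^esub> inv\<^bsub>G\<^esub> (inv\<^bsub>G\<^esub> ?y) = eval_list L"
      using Cons y M G.inv_cancel(1)[OF y M(1)] by simp
    ultimately show ?thesis
      using G.virtual_retract_conj[OF r, of "inv\<^bsub>G\<^esub> ?y"] y M by simp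
  qed (use r in simp)
qed simp

text \<open>Cyclic reduction, by induction on the length. A pinch, possibly across the end of the
  list, is rotated to the front, where it collapses into an element \<open>x\<close> of
  \<open>A\<close>; this is absorbed by the next syllable, or is the whole value if none remains.
  Without a pinch the list is cyclically reduced.\<close>

lemma virtual_retract_eval_list:
  "L \<noteq> [] \<Longrightarrow> fst ` set L \<subseteq> carrier A \<Longrightarrow> virtual_retract (generate G {eval_list L}) G"
proof (induction "length L" arbitrary: L rule: less_induct)
  case less
  show ?case
  proof (cases "\<exists>i<length L. snd (L ! i) \<noteq> snd (L ! (Suc i mod length L)) \<and>
      fst (L ! (Suc i mod length L)) \<in> assoc_subgroup (snd (L ! (Suc i mod length L)))")
    case False
    then show ?thesis
      using virtual_retract_reduced[OF less.prems] by blast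
  next
    case True
    then obtain i where i: "i < length L" "snd (L ! i) \<noteq> snd (L ! (Suc i mod length L))"
      "fst (L ! (Suc i mod length L)) \<in> assoc_subgroup (snd (L ! (Suc i mod length L)))"
      by blast
    \<comment> \<open>A single syllable is its own cyclic successor, so its exponent cannot
      change.\<close>
    have "length L \<noteq> 1"
      using i by auto
    then have len: "length L > 1"
      using i by linarith
    obtain l0 l1 R where R: "rotate i L = l0 # l1 # R"
    proof -
      have "Suc (Suc 0) \<le> length (rotate i L)"
        using len by simp
      then show thesis
        using that unfolding Suc_le_length_iff by blast
    qed
    have l: "l0 = L ! i" "l1 = L ! (Suc i mod length L)"
      using nth_rotate[of 0 L i] nth_rotate[of 1 L i] len i(1) R less.prems(1) by simp_all
    have sub: "fst ` set (l0 # l1 # R) \<subseteq> carrier A"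
      using less.prems(2) R by (metis set_rotate)
    have se: "snd l0 = (\<not> snd l1)" using i(2) l by simp
    obtain y where y: "y \<in> carrier A"
      "stable_pow (snd l1) \<otimes>\<^bsub>G\<^esub> base (fst l1) \<otimes>\<^bsub>G\<^esub> stable_pow (snd l0) = base y"
      using stable_pow_pinch[of "fst l1" "snd l1"] i(3) l se by auto
    define x where "x = y \<otimes> fst l0"
    have x: "x \<in> carrier A" using y(1) sub by (simp add: x_def)
    have ev: "eval_list (rotate i L) = eval_list R \<otimes>\<^bsub>G\<^esub> base x"
    proof -
      have "eval_list (rotate i L) = eval_list R \<otimes>\<^bsub>G\<^esub>
          (stable_pow (snd l1) \<otimes>\<^bsub>G\<^esub> base (fst l1) \<otimes>\<^bsub>G\<^esub> stable_pow (snd l0) \<otimes>\<^bsub>G\<^esub> base (fst l0))"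
        using R sub by (simp add: G.m_assoc)
      then show ?thesis
        unfolding y(2) using y(1) sub by (simp add: x_def base_mult)
    qed
    have "virtual_retract (generate G {eval_list (rotate i L)}) G"
    proof (cases R)
      case Nil
      then show ?thesis using ev virtual_retract_base[OF x] x by simp
    next
      case (Cons l R')
      let ?L = "(fst l \<otimes> x, snd l) # R'"
      have "eval_list ?L = eval_list R \<otimes>\<^bsub>G\<^esub> base x"
        using Cons x sub by (simp add: base_mult G.m_assoc)
      moreover have "length ?L < length L"
        using R Cons by (metis length_rotate length_Cons lessI less_SucI)
      ultimately show ?thesis
        using less.hyps[of ?L] ev sub x Cons by simp
    qed
    then show ?thesis
      using virtual_retract_rotate less.prems(2) by blast
  qed
qed

text \<open>The product for a nonempty list begins on the left with a stable letter or its inverse,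
  so an element of \<open>A\<close> in front is kept separately.\<close>

lemma ex_base_mult_eval_list:
  assumes "g \<in> carrier G"
  shows "\<exists>x\<in>carrier A. \<exists>L. fst ` set L \<subseteq> carrier A \<and> g = base x \<otimes>\<^bsub>G\<^esub> eval_list L"
proof -
  have st: "\<exists>x\<in>carrier A. \<exists>L. fst ` set L \<subseteq> carrier A \<and> stable_pow e \<otimes>\<^bsub>G\<^esub> g = base x \<otimes>\<^bsub>G\<^esub> eval_list L"
    if g: "\<exists>x\<in>carrier A. \<exists>L. fst ` set L \<subseteq> carrier A \<and> g = base x \<otimes>\<^bsub>G\<^esub> eval_list L" for e g
  proof -
    obtain x L where xL: "x \<in> carrier A" "fst ` set L \<subseteq> carrier A" "g = base x \<otimes>\<^bsub>G\<^esub> eval_list L"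
      using g by blast
    \<comment> \<open>The pending \<open>x\<close> becomes the coefficient of a new syllable, put at
      the end because the end of the list acts last.\<close>
    have "stable_pow e \<otimes>\<^bsub>G\<^esub> g = base \<one> \<otimes>\<^bsub>G\<^esub> eval_list (L @ [(x, e)])"
      using xL by (simp add: eval_list_append G.m_assoc)
    then show ?thesis
      using xL by (intro bexI[of _ \<one>] exI[of _ "L @ [(x, e)]"]) auto
  qed
  show ?thesis
    using assms
  proof (induction rule: G_induct)
    case one
    show ?case by (intro bexI[of _ \<one>] exI[of _ "[]"]) auto
  next
    case (base y g)
    then obtain x L where xL: "x \<in> carrier A" "fst ` set L \<subseteq> carrier A" "g = base x \<otimes>\<^bsub>G\<^esub> eval_list L"
      by blast
    have "base y \<otimes>\<^bsub>G\<^esub> g = base (y \<otimes> x) \<otimes>\<^bsub>G\<^esub> eval_list L"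
      using xL base(1) by (simp add: base_mult G.m_assoc)
    then show ?case using xL base(1) A.m_closed by blast
  next
    case (stable g)
    then show ?case using st[of g True] by (simp add: stable_pow_def)
  next
    case (stable_inv g)
    then show ?case using st[of g False] by (simp add: stable_pow_def)
  qed
qed

lemma G_property_VRC: "property_VRC G"
  unfolding property_VRC_def
proof
  fix g assume "g \<in> carrier G"
  then obtain x L where x: "x \<in> carrier A" and L: "fst ` set L \<subseteq> carrier A" and g: "g = base x \<otimes>\<^bsub>G\<^esub> eval_list L"
    using ex_base_mult_eval_list by blast
  show "virtual_retract (generate G {g}) G"
  proof (cases L)
    case Nil
    then show ?thesis using g x virtual_retract_base by simp
  next
    case (Cons l M)
    \<comment> \<open>Up to conjugation by \<open>base x\<close> the element in front moves to the
      other end of the product, where it merges with the syllable acting first.\<close>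
    let ?L = "(fst l \<otimes> x, snd l) # M"
    have ev: "eval_list ?L = eval_list L \<otimes>\<^bsub>G\<^esub> base x"
      using Cons x L by (simp add: base_mult G.m_assoc)
    have "virtual_retract (generate G {eval_list ?L}) G"
      by (rule virtual_retract_eval_list) (use Cons L x in auto)
    then have "virtual_retract (generate G {base x \<otimes>\<^bsub>G\<^esub> (eval_list L \<otimes>\<^bsub>G\<^esub> base x) \<otimes>\<^bsub>G\<^esub> inv\<^bsub>G\<^esub> (base x)}) G"
      unfolding ev using x L by (intro G.virtual_retract_conj) simp_all
    moreover have "base x \<otimes>\<^bsub>G\<^esub> (eval_list L \<otimes>\<^bsub>G\<^esub> base x) \<otimes>\<^bsub>G\<^esub> inv\<^bsub>G\<^esub> (base x) = g"
      using x L g by (simp add: G.m_assoc del: base.hom_inv)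
    ultimately show ?thesis by simp
  qed
qed

end

theorem corollary9p8:
  fixes A :: "('a, 'm) monoid_scheme" and a b :: 'a
  assumes "comm_group A"
    and "finitely_generated_group A"
    and "a \<in> carrier A" and "b \<in> carrier A"
    and "group.ord A a = group.ord A b"
  defines "G \<equiv> hnn_extension A a b"
  shows "(property_VRC G \<longleftrightarrow> balanced G) \<and>
    (balanced G \<longleftrightarrow>
      generate A {a} \<inter> generate A {b} = {\<one>\<^bsub>A\<^esub>} \<or>
      (\<exists>m::nat. m > 0 \<and> (b [^]\<^bsub>A\<^esub> m = a [^]\<^bsub>A\<^esub> m \<or> b [^]\<^bsub>A\<^esub> m = a [^]\<^bsub>A\<^esub> (- int m))))"
proof -
  interpret H: hnn A a b
    using assms by (simp add: hnn_def hnn_axioms_def)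
  have G: "G = H.G" by (simp add: G_def H.G_def)
  have "property_VRC G" if "H.A.hnn_condition a b"
  proof -
    interpret compatible_hnn A a b
      using that assms by unfold_locales
    show ?thesis unfolding G by (rule G_property_VRC)
  qed
  moreover have "balanced G" if "property_VRC G"
    using H.G.VRC_imp_balanced that unfolding G .
  moreover have "H.A.hnn_condition a b" if "balanced G"
    using H.balanced_imp_hnn_condition assms that unfolding G by blast
  ultimately show ?thesis
    unfolding H.A.hnn_condition_def[symmetric] by blast
qed

end
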